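(* If a network is asymptotically linearly solvable over some module or over some finite ring, then it is asymptotically linearly solvable over some finite field.
   Context: Rings are associative with identity $1$, not necessarily commutative. A module ${}_R G$ is a left (unital) $R$-module $G$ whose underlying Abelian group $G$ is finite; the ring $R$ need not be finite. Groups and rings used as alphabets have at least two elements. A network is a finite directed acyclic multigraph, some of whose nodes are sources or receivers, with finitely many message vectors (say $m$ of them), each originating at a source node; each receiver demands a specified set of the message vectors. The inputs of a node are the message vectors originating at the node together with the vectors carried by its incoming edges. For integers $k_1,\dots,k_m\ge 0$ and $n\ge 1$, a $(k_1,\dots,k_m,n)$ code over a finite alphabet $\mathcal{A}$ (with $|\mathcal{A}|\ge 2$) lets the $i$th message vector range over $\mathcal{A}^{k_i}$, assigns to each edge an edge function mapping the inputs of the edge's tail node to a vector in $\mathcal{A}^n$ (the vector carried by the edge), and assigns to each receiver and each message vector it demands a decoding function of the receiver's inputs. The code is a solution if, for all values of the message vectors, each decoding function outputs the demanded message vector. Its rate vector is $(k_1/n,\dots,k_m/n)$. A code over the alphabet $\mathcal{A}=G$ is linear over the module ${}_R G$ if every edge function and decoding function is of the form $\mathbf{x}\mapsto A\mathbf{x}$, where $\mathbf{x}$ is the concatenation (a vector over $G$) of the input vectors of the node, $A$ is a matrix with entries in $R$, and entries of $A$ multiply entries of $\mathbf{x}$ via the module action. A linear code over a finite ring $R$ is a code linear over the left $R\otimes_{\mathbb{Z}}R^{op}$-module $R$ with action $\left(\sum_i a_i\otimes b_i\right)\cdot x=\sum_i a_i x b_i$ (two-sided linearity); for a field this is ordinary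 linearity. A network is asymptotically linearly solvable over a module (respectively ring, field) if for every rational $\epsilon\in(0,1)$ it has a linear solution over that module (respectively ring, field), for some block sizes, with rate vector $(1-\epsilon,\dots,1-\epsilon)$. *)

theory Defs
  imports
    "HOL-Library.Poly_Mapping"
    "HOL-Library.FuncSet"
    "Graph_Theory.Digraph"
    "HOL-Algebra.Algebra"
begin

section \<open>Modules over rings that need not be commutative\<close>

text \<open>The locale \<^locale>\<open>module\<close> of HOL-Algebra requires a commutative ring of scalars.  As there,
  the fields \<^const>\<open>monoid.mult\<close> and \<^const>\<open>monoid.one\<close> of the module record carry no meaning.\<close>

locale left_module = R?: ring R + M?: abelian_group M
  for R :: "('a, 'm) ring_scheme" (structure) and M :: "('a, 'b, 'n) module_scheme" (structure) +
  assumes smult_closed [simp, intro]: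
      "\<lbrakk>a \<in> carrier R; x \<in> carrier M\<rbrakk> \<Longrightarrow> a \<odot>\<^bsub>M\<^esub> x \<in> carrier M"
    and smult_l_distr:
      "\<lbrakk>a \<in> carrier R; b \<in> carrier R; x \<in> carrier M\<rbrakk>
        \<Longrightarrow> (a \<oplus> b) \<odot>\<^bsub>M\<^esub> x = a \<odot>\<^bsub>M\<^esub> x \<oplus>\<^bsub>M\<^esub> b \<odot>\<^bsub>M\<^esub> x"
    and smult_r_distr:
      "\<lbrakk>a \<in> carrier R; x \<in> carrier M; y \<in> carrier M\<rbrakk>
        \<Longrightarrow> a \<odot>\<^bsub>M\<^esub> (x \<oplus>\<^bsub>M\<^esub> y) = a \<odot>\<^bsub>M\<^esub> x \<oplus>\<^bsub>M\<^esub> a \<odot>\<^bsub>M\<^esub> y"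
    and smult_assoc1:
      "\<lbrakk>a \<in> carrier R; b \<in> carrier R; x \<in> carrier M\<rbrakk>
        \<Longrightarrow> (a \<otimes> b) \<odot>\<^bsub>M\<^esub> x = a \<odot>\<^bsub>M\<^esub> (b \<odot>\<^bsub>M\<^esub> x)"
    and smult_one [simp]: "x \<in> carrier M \<Longrightarrow> \<one> \<odot>\<^bsub>M\<^esub> x = x"


section \<open>The tensor product of rings and two-sided multiplication\<close>

definition opposite_ring :: "('a, 'm) ring_scheme \<Rightarrow> ('a, 'm) ring_scheme" where
  "opposite_ring R = R\<lparr>monoid.mult := \<lambda>x y. y \<otimes>\<^bsub>R\<^esub> x\<rparr>"

text \<open>The tensor product over the integers is the free abelian group on the pairs, with
  multiplication extending \<open>(a, b) (c, d) = (a c, b d)\<close> bilinearly, modulo the relations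
  making pairs additive in each component.\<close>

definition formal_tensor_ring ::
    "('a, 'm) ring_scheme \<Rightarrow> ('b, 'n) ring_scheme \<Rightarrow> ('a \<times> 'b \<Rightarrow>\<^sub>0 int) ring" where
  "formal_tensor_ring R S =
    \<lparr>carrier = {f. Poly_Mapping.keys f \<subseteq> carrier R \<times> carrier S},
     monoid.mult = \<lambda>f g. frag_extend (\<lambda>p. frag_extend
              (\<lambda>q. frag_of (fst p \<otimes>\<^bsub>R\<^esub> fst q, snd p \<otimes>\<^bsub>S\<^esub> snd q)) g) f,
     monoid.one = frag_of (\<one>\<^bsub>R\<^esub>, \<one>\<^bsub>S\<^esub>),
     ring.zero = 0,
     ring.add = (+)\<rparr>"

definition tensor_relations ::
    "('a, 'm) ring_scheme \<Rightarrow> ('b, 'n) ring_scheme \<Rightarrow> ('a \<times> 'b \<Rightarrow>\<^sub>0 int) set" where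
  "tensor_relations R S =
    {frag_of (a \<oplus>\<^bsub>R\<^esub> a', b) - frag_of (a, b) - frag_of (a', b) | a a' b.
       a \<in> carrier R \<and> a' \<in> carrier R \<and> b \<in> carrier S} \<union>
    {frag_of (a, b \<oplus>\<^bsub>S\<^esub> b') - frag_of (a, b) - frag_of (a, b') | a b b'.
       a \<in> carrier R \<and> b \<in> carrier S \<and> b' \<in> carrier S}"

definition tensor_ring ::
    "('a, 'm) ring_scheme \<Rightarrow> ('b, 'n) ring_scheme \<Rightarrow> ('a \<times> 'b \<Rightarrow>\<^sub>0 int) set ring" where
  "tensor_ring R S =
    formal_tensor_ring R S Quot (Idl\<^bsub>formal_tensor_ring R S\<^esub> (tensor_relations R S))"

definition sandwich :: "('a, 'm) ring_scheme \<Rightarrow> ('a \<times> 'a \<Rightarrow>\<^sub>0 int) \<Rightarrow> 'a \<Rightarrow> 'a" where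
  "sandwich R f x = (\<Oplus>\<^bsub>R\<^esub>p\<in>Poly_Mapping.keys f.
     [Poly_Mapping.lookup f p] \<cdot>\<^bsub>R\<^esub> (fst p \<otimes>\<^bsub>R\<^esub> x \<otimes>\<^bsub>R\<^esub> snd p))"

text \<open>The ring \<open>R\<close> as a module over its tensor product with its opposite.  All representatives of
  a tensor act alike (lemma \<open>smult_two_sided_module\<close> below), so \<^const>\<open>the_elem\<close> is applied
  to a singleton.\<close>

definition two_sided_module :: "'a ring \<Rightarrow> (('a \<times> 'a \<Rightarrow>\<^sub>0 int) set, 'a) module" where
  "two_sided_module R =
    \<lparr>carrier = carrier R, monoid.mult = monoid.mult R, monoid.one = monoid.one R, ring.zero = ring.zero R, ring.add = ring.add R,
     smult = \<lambda>t x. the_elem ((\<lambda>f. sandwich R f x) ` t)\<rparr>"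

lemma formal_tensor_ring_is_ring:
  assumes "ring R" "ring S"
  shows "ring (formal_tensor_ring R S)"
proof -
  interpret R: ring R by fact
  interpret S: ring S by fact
  let ?F = "formal_tensor_ring R S"
  let ?C = "carrier R \<times> carrier S"
  let ?pm = "\<lambda>p q. (fst p \<otimes>\<^bsub>R\<^esub> fst q, snd p \<otimes>\<^bsub>S\<^esub> snd q)"
  have sum_keys: "Poly_Mapping.keys (frag_extend h f) \<subseteq> ?C"
    if "Poly_Mapping.keys f \<subseteq> ?C" "\<And>p. p \<in> ?C \<Longrightarrow> Poly_Mapping.keys (h p) \<subseteq> ?C"
    for h :: "'a \<times> 'c \<Rightarrow> ('a \<times> 'c \<Rightarrow>\<^sub>0 int)" and f
    using keys_frag_extend[of h f] that by blast
  have mult_eq: "f \<otimes>\<^bsub>?F\<^esub> g = frag_extend (\<lambda>p. frag_extend (\<lambda>q. frag_of (?pm p q)) g) f" for f g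
    by (simp add: formal_tensor_ring_def)
  have add_eq: "f \<oplus>\<^bsub>?F\<^esub> g = f + g" for f g
    by (simp add: formal_tensor_ring_def)
  have carr: "f \<in> carrier ?F \<longleftrightarrow> Poly_Mapping.keys f \<subseteq> ?C" for f
    by (simp add: formal_tensor_ring_def)
  have ldist: "(f + g) \<otimes>\<^bsub>?F\<^esub> h = f \<otimes>\<^bsub>?F\<^esub> h + g \<otimes>\<^bsub>?F\<^esub> h" for f g h
    by (simp add: mult_eq frag_extend_add)
  have ldiff: "(f - g) \<otimes>\<^bsub>?F\<^esub> h = f \<otimes>\<^bsub>?F\<^esub> h - g \<otimes>\<^bsub>?F\<^esub> h" for f g h
    by (simp add: mult_eq frag_extend_diff)
  have rdist: "h \<otimes>\<^bsub>?F\<^esub> (f + g) = h \<otimes>\<^bsub>?F\<^esub> f + h \<otimes>\<^bsub>?F\<^esub> g" for f g h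
    by (simp add: mult_eq frag_extend_add)
       (simp add: frag_extend_def frag_cmul_distrib2 sum.distrib)
  have rdiff: "h \<otimes>\<^bsub>?F\<^esub> (f - g) = h \<otimes>\<^bsub>?F\<^esub> f - h \<otimes>\<^bsub>?F\<^esub> g" for f g h
    using rdist[of h "f - g" g] by (simp add: algebra_simps)
  have zl: "0 \<otimes>\<^bsub>?F\<^esub> h = 0" and zr: "h \<otimes>\<^bsub>?F\<^esub> 0 = 0" for h
    using ldist[of 0 0 h] rdist[of h 0 0] by simp_all
  have ofof: "frag_of p \<otimes>\<^bsub>?F\<^esub> frag_of q = frag_of (?pm p q)" for p q
    by (simp add: mult_eq)
  have keys_of: "Poly_Mapping.keys (frag_of p) \<subseteq> ?C \<longleftrightarrow> p \<in> ?C" for p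
    by (simp add: keys_frag_of)
  have mclosed: "f \<otimes>\<^bsub>?F\<^esub> g \<in> carrier ?F" if "f \<in> carrier ?F" "g \<in> carrier ?F" for f g
    using that unfolding carr mult_eq
    by (intro sum_keys) (auto simp: keys_frag_of)
  have "(f \<otimes>\<^bsub>?F\<^esub> g) \<otimes>\<^bsub>?F\<^esub> h = f \<otimes>\<^bsub>?F\<^esub> (g \<otimes>\<^bsub>?F\<^esub> h)"
    if f: "f \<in> carrier ?F" and g: "g \<in> carrier ?F" and h: "h \<in> carrier ?F" for f g h
    using f[unfolded carr]
  proof (induction f rule: frag_induction)
    case (one p)
    show ?case using g[unfolded carr]
    proof (induction g rule: frag_induction)
      case (one q)
      show ?case using h[unfolded carr]
      proof (induction h rule: frag_induction)
        case (one r)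
        then show ?case using \<open>p \<in> ?C\<close> \<open>q \<in> ?C\<close>
          by (auto simp: ofof R.m_assoc S.m_assoc)
      qed (simp_all add: zl zr ldiff rdiff)
    qed (simp_all add: zl zr ldiff rdiff)
  qed (simp_all add: zl zr ldiff rdiff)
  moreover have "\<one>\<^bsub>?F\<^esub> \<otimes>\<^bsub>?F\<^esub> f = f" if f: "f \<in> carrier ?F" for f
    using f[unfolded carr]
  proof (induction f rule: frag_induction)
    case (one p) then show ?case
      using ofof[of "(\<one>\<^bsub>R\<^esub>, \<one>\<^bsub>S\<^esub>)" p] by (auto simp: formal_tensor_ring_def)
  qed (simp_all add: zr rdiff)
  moreover have "f \<otimes>\<^bsub>?F\<^esub> \<one>\<^bsub>?F\<^esub> = f" if f: "f \<in> carrier ?F" for f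
    using f[unfolded carr]
  proof (induction f rule: frag_induction)
    case (one p) then show ?case
      using ofof[of p "(\<one>\<^bsub>R\<^esub>, \<one>\<^bsub>S\<^esub>)"] by (auto simp: formal_tensor_ring_def)
  qed (simp_all add: zl ldiff)
  moreover have "\<one>\<^bsub>?F\<^esub> \<in> carrier ?F"
    by (simp add: formal_tensor_ring_def keys_frag_of)
  ultimately have "monoid ?F"
    using mclosed by unfold_locales auto
  moreover have "abelian_group ?F"
  proof (rule abelian_groupI)
    fix x assume "x \<in> carrier ?F"
    then show "\<exists>y\<in>carrier ?F. y \<oplus>\<^bsub>?F\<^esub> x = \<zero>\<^bsub>?F\<^esub>"
      by (intro bexI[of _ "- x"]) (auto simp: formal_tensor_ring_def)
  next
    fix x y assume "x \<in> carrier ?F" "y \<in> carrier ?F"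
    then show "x \<oplus>\<^bsub>?F\<^esub> y \<in> carrier ?F"
      using keys_add[of x y] by (auto simp: formal_tensor_ring_def)
  qed (auto simp: formal_tensor_ring_def algebra_simps)
  ultimately show ?thesis
    by (intro ringI) (simp_all add: add_eq ldist rdist)
qed

lemma tensor_relations_subset:
  assumes "ring R" "ring S"
  shows "tensor_relations R S \<subseteq> carrier (formal_tensor_ring R S)"
proof -
  interpret R: ring R by fact
  interpret S: ring S by fact
  have d: "frag_of x - frag_of y - frag_of z \<in> carrier (formal_tensor_ring R S)"
    if "x \<in> carrier R \<times> carrier S" "y \<in> carrier R \<times> carrier S" "z \<in> carrier R \<times> carrier S"
    for x y z
    using that keys_diff[of "frag_of x" "frag_of y"] keys_diff[of "frag_of x - frag_of y" "frag_of z"]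
    by (force simp: formal_tensor_ring_def keys_frag_of)
  show ?thesis
    unfolding tensor_relations_def by (auto intro!: d)
qed

lemma tensor_ring_is_ring:
  assumes "ring R" "ring S"
  shows "ring (tensor_ring R S)"
  unfolding tensor_ring_def
  by (intro ideal.quotient_is_ring ring.genideal_ideal formal_tensor_ring_is_ring
      tensor_relations_subset assms)

lemma opposite_ring_is_ring:
  assumes "ring R"
  shows "ring (opposite_ring R)"
proof -
  interpret R: ring R by fact
  have "abelian_group (opposite_ring R)"
    by (rule abelian_groupI)
       (auto simp: opposite_ring_def R.a_ac intro!: bexI[of _ "\<ominus>\<^bsub>R\<^esub> _"] R.l_neg)
  moreover have "monoid (opposite_ring R)"
    by unfold_locales (auto simp: opposite_ring_def R.m_assoc)
  ultimately show ?thesis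
    by (rule ringI) (auto simp: opposite_ring_def R.l_distr R.r_distr)
qed

context ring
begin

abbreviation formal_envelope :: "('a \<times> 'a \<Rightarrow>\<^sub>0 int) ring" where
  "formal_envelope \<equiv> formal_tensor_ring R (opposite_ring R)"

lemma carrier_formal_envelope:
  "f \<in> carrier formal_envelope \<longleftrightarrow> Poly_Mapping.keys f \<subseteq> carrier R \<times> carrier R"
  by (simp add: formal_tensor_ring_def opposite_ring_def)

lemma sandwich_superset:
  assumes "Poly_Mapping.keys f \<subseteq> K" "finite K" "K \<subseteq> carrier R \<times> carrier R" "x \<in> carrier R"
  shows "sandwich R f x =
    (\<Oplus>p\<in>K. [Poly_Mapping.lookup f p] \<cdot> (fst p \<otimes> x \<otimes> snd p))"
  unfolding sandwich_def
proof (rule add.finprod_mono_neutral_cong_left)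
  show "[Poly_Mapping.lookup f p] \<cdot> (fst p \<otimes> x \<otimes> snd p) = \<zero>"
    if "p \<in> K - Poly_Mapping.keys f" for p
    using that by (simp add: in_keys_iff add_pow_def)
qed (use assms in auto)

lemma sandwich_closed:
  assumes "f \<in> carrier formal_envelope" "x \<in> carrier R"
  shows "sandwich R f x \<in> carrier R"
  unfolding sandwich_def
  using assms by (intro finsum_closed) (auto simp: carrier_formal_envelope)

lemma sandwich_add:
  assumes f: "f \<in> carrier formal_envelope" and g: "g \<in> carrier formal_envelope"
    and x: "x \<in> carrier R"
  shows "sandwich R (f + g) x = sandwich R f x \<oplus> sandwich R g x"
proof -
  let ?K = "Poly_Mapping.keys f \<union> Poly_Mapping.keys g"
  have K: "finite ?K" "?K \<subseteq> carrier R \<times> carrier R"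
    using f g by (auto simp: carrier_formal_envelope)
  have c: "fst p \<otimes> x \<otimes> snd p \<in> carrier R" if "p \<in> ?K" for p
    using that K x by auto
  have "sandwich R (f + g) x =
      (\<Oplus>p\<in>?K. [Poly_Mapping.lookup (f + g) p] \<cdot> (fst p \<otimes> x \<otimes> snd p))"
    using K x keys_add[of f g] by (intro sandwich_superset) auto
  also have "\<dots> = (\<Oplus>p\<in>?K. [Poly_Mapping.lookup f p] \<cdot> (fst p \<otimes> x \<otimes> snd p) \<oplus>
      [Poly_Mapping.lookup g p] \<cdot> (fst p \<otimes> x \<otimes> snd p))"
    using c by (intro finsum_cong')
      (auto simp: lookup_add add.int_pow_mult)
  also have "\<dots> = sandwich R f x \<oplus> sandwich R g x"
    using K x c
    by (subst finsum_addf) (auto simp: sandwich_superset[of _ ?K])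
  finally show ?thesis .
qed

lemma formal_envelope_diff_closed:
  assumes "f \<in> carrier formal_envelope" "g \<in> carrier formal_envelope"
  shows "f - g \<in> carrier formal_envelope"
  using assms keys_diff[of f g] by (auto simp: carrier_formal_envelope)

lemma sandwich_diff:
  assumes f: "f \<in> carrier formal_envelope" and g: "g \<in> carrier formal_envelope"
    and x: "x \<in> carrier R"
  shows "sandwich R (f - g) x = sandwich R f x \<ominus> sandwich R g x"
proof -
  have "sandwich R f x = sandwich R (f - g) x \<oplus> sandwich R g x"
    using sandwich_add[of "f - g" g x] formal_envelope_diff_closed[OF f g] g x by simp
  then show ?thesis
    using sandwich_closed[OF formal_envelope_diff_closed[OF f g] x] sandwich_closed[OF g x]
    by (simp add: a_minus_def a_assoc r_neg)
qed

lemma sandwich_0: "sandwich R 0 x = \<zero>"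
  by (simp add: sandwich_def)

lemma sandwich_frag_of:
  assumes "a \<in> carrier R" "b \<in> carrier R" "x \<in> carrier R"
  shows "sandwich R (frag_of (a, b)) x = a \<otimes> x \<otimes> b"
  using assms by (simp add: sandwich_def keys_frag_of)

lemma sandwich_r_add:
  assumes f: "f \<in> carrier formal_envelope" and x: "x \<in> carrier R" and y: "y \<in> carrier R"
  shows "sandwich R f (x \<oplus> y) = sandwich R f x \<oplus> sandwich R f y"
proof -
  have "f \<in> carrier formal_envelope \<and> sandwich R f (x \<oplus> y) = sandwich R f x \<oplus> sandwich R f y"
    using f[unfolded carrier_formal_envelope]
  proof (induction f rule: frag_induction)
    case zero then show ?case by (simp add: sandwich_0 carrier_formal_envelope)
  next
    case (one p) then show ?case using x y
      by (cases p) (simp add: sandwich_frag_of carrier_formal_envelope keys_frag_of l_distr r_distr)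
  next
    case (diff f g)
    then have c: "f \<in> carrier formal_envelope" "g \<in> carrier formal_envelope" by auto
    have s: "sandwich R f x \<in> carrier R" "sandwich R f y \<in> carrier R"
      "sandwich R g x \<in> carrier R" "sandwich R g y \<in> carrier R"
      using c x y by (simp_all add: sandwich_closed)
    show ?case
      using diff c x y s
      by (simp add: sandwich_diff formal_envelope_diff_closed a_minus_def minus_add a_ac)
  qed
  then show ?thesis ..
qed

lemma sandwich_mult:
  assumes f: "f \<in> carrier formal_envelope" and g: "g \<in> carrier formal_envelope"
    and x: "x \<in> carrier R"
  shows "sandwich R (f \<otimes>\<^bsub>formal_envelope\<^esub> g) x = sandwich R f (sandwich R g x)"
proof -
  let ?F = formal_envelope
  interpret F: ring ?F
    by (intro formal_tensor_ring_is_ring opposite_ring_is_ring ring_axioms)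
  have minus: "u \<ominus>\<^bsub>?F\<^esub> v = u - v" if "u \<in> carrier ?F" "v \<in> carrier ?F" for u v
  proof -
    have "(u - v) \<oplus>\<^bsub>?F\<^esub> v = u" by (simp add: formal_tensor_ring_def)
    then show ?thesis
      using that formal_envelope_diff_closed[OF that]
      by (metis F.add.inv_solve_right' F.minus_eq)
  qed
  have ldiff: "(u - v) \<otimes>\<^bsub>?F\<^esub> w = u \<otimes>\<^bsub>?F\<^esub> w - v \<otimes>\<^bsub>?F\<^esub> w"
    for u v w
    by (simp add: formal_tensor_ring_def frag_extend_diff)
  have rdiff: "w \<otimes>\<^bsub>?F\<^esub> (u - v) = w \<otimes>\<^bsub>?F\<^esub> u - w \<otimes>\<^bsub>?F\<^esub> v"
    if "u \<in> carrier ?F" "v \<in> carrier ?F" "w \<in> carrier ?F" for u v w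
    using F.r_distr[of u "\<ominus>\<^bsub>?F\<^esub> v" w] that minus[of u v]
      minus[of "w \<otimes>\<^bsub>?F\<^esub> u" "w \<otimes>\<^bsub>?F\<^esub> v"]
    by (simp add: F.minus_eq F.r_minus)
  have F0: "0 = \<zero>\<^bsub>?F\<^esub>" by (simp add: formal_tensor_ring_def)
  have sw_minus: "sandwich R u (y \<ominus> z) = sandwich R u y \<ominus> sandwich R u z"
    if u: "u \<in> carrier ?F" and y: "y \<in> carrier R" and z: "z \<in> carrier R" for u y z
  proof -
    have "sandwich R u y = sandwich R u ((y \<ominus> z) \<oplus> z)"
      using y z by (simp add: a_minus_def a_assoc l_neg)
    also have "\<dots> = sandwich R u (y \<ominus> z) \<oplus> sandwich R u z"
      using u y z by (simp add: sandwich_r_add)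
    finally show ?thesis
      using sandwich_closed[OF u, of "y \<ominus> z"] sandwich_closed[OF u z] y z
      by (simp add: a_minus_def a_assoc r_neg)
  qed
  have sw0: "sandwich R u \<zero> = \<zero>" if u: "u \<in> carrier ?F" for u
    using sw_minus[OF u, of \<zero> \<zero>] sandwich_closed[OF u, of \<zero>] by (simp add: a_minus_def r_neg)
  have "f \<in> carrier ?F \<and> sandwich R (f \<otimes>\<^bsub>?F\<^esub> g) x = sandwich R f (sandwich R g x)"
    using f[unfolded carrier_formal_envelope]
  proof (induction f rule: frag_induction)
    case zero then show ?case
      using F.l_null[OF g, folded F0] by (simp add: sandwich_0 carrier_formal_envelope)
  next
    case (one p)
    then have p: "frag_of p \<in> carrier ?F" by (simp add: carrier_formal_envelope keys_frag_of)
    have "g \<in> carrier ?F \<and>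
        sandwich R (frag_of p \<otimes>\<^bsub>?F\<^esub> g) x = sandwich R (frag_of p) (sandwich R g x)"
      using g[unfolded carrier_formal_envelope]
    proof (induction g rule: frag_induction)
      case zero then show ?case
        using F.r_null[OF p, folded F0] sw0[OF p] by (simp add: sandwich_0 carrier_formal_envelope)
    next
      case (one q)
      obtain a b c d where pq: "p = (a, b)" "q = (c, d)" by (cases p, cases q)
      have ab: "a \<in> carrier R" "b \<in> carrier R" "c \<in> carrier R" "d \<in> carrier R"
        using one \<open>p \<in> _\<close> pq by auto
      have "frag_of p \<otimes>\<^bsub>?F\<^esub> frag_of q = frag_of (a \<otimes> c, d \<otimes> b)"
        by (simp add: formal_tensor_ring_def opposite_ring_def pq)
      then show ?case
        using ab x by (simp add: pq sandwich_frag_of carrier_formal_envelope keys_frag_of m_assoc)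
    next
      case (diff u v)
      then show ?case
        using p x by (simp add: rdiff sandwich_diff formal_envelope_diff_closed sw_minus sandwich_closed)
    qed
    then show ?case using p by simp
  next
    case (diff u v)
    then show ?case
      using g x by (simp add: ldiff sandwich_diff formal_envelope_diff_closed sandwich_closed)
  qed
  then show ?thesis ..
qed

lemma sandwich_relations:
  assumes "f \<in> Idl\<^bsub>formal_envelope\<^esub> (tensor_relations R (opposite_ring R))" "x \<in> carrier R"
  shows "sandwich R f x = \<zero>"
proof -
  let ?F = formal_envelope
  let ?I = "{f \<in> carrier ?F. \<forall>x\<in>carrier R. sandwich R f x = \<zero>}"
  interpret F: ring ?F
    by (intro formal_tensor_ring_is_ring opposite_ring_is_ring ring_axioms)
  have add: "u \<oplus>\<^bsub>?F\<^esub> v = u + v" for u v by (simp add: formal_tensor_ring_def)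
  have zero: "\<zero>\<^bsub>?F\<^esub> = 0" by (simp add: formal_tensor_ring_def)
  have s0: "sandwich R u \<zero> = \<zero>" if u: "u \<in> carrier ?F" for u
    using sandwich_r_add[OF u, of \<zero> \<zero>] sandwich_closed[OF u, of \<zero>]
    by (simp add: add.l_cancel_one)
  have inv: "\<ominus>\<^bsub>?F\<^esub> u = 0 - u" if "u \<in> carrier ?F" for u
    using that formal_envelope_diff_closed[of 0 u]
    by (intro F.minus_equality) (auto simp: add zero carrier_formal_envelope)
  have gen: "frag_of (a, b) \<in> carrier ?F" if "a \<in> carrier R" "b \<in> carrier R" for a b
    using that by (simp add: carrier_formal_envelope keys_frag_of)
  have z: "0 \<in> carrier ?F" by (simp add: carrier_formal_envelope)
  have "ideal ?I ?F"
  proof (rule idealI[OF F.ring_axioms])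
    show "subgroup ?I (add_monoid ?F)"
    proof
      show "?I \<subseteq> carrier (add_monoid ?F)" by auto
      show "u \<otimes>\<^bsub>add_monoid ?F\<^esub> v \<in> ?I" if "u \<in> ?I" "v \<in> ?I" for u v
        using that F.a_closed[of u v] by (auto simp: add sandwich_add)
      show "\<one>\<^bsub>add_monoid ?F\<^esub> \<in> ?I"
        using z by (auto simp: zero sandwich_0)
      show "inv\<^bsub>add_monoid ?F\<^esub> u \<in> ?I" if u: "u \<in> ?I" for u
      proof -
        have "inv\<^bsub>add_monoid ?F\<^esub> u = 0 - u"
          using u inv[of u] by (simp add: a_inv_def)
        then show ?thesis
          using u formal_envelope_diff_closed[OF z, of u]
          by (simp add: sandwich_diff[OF z] sandwich_0 a_minus_def del: diff_0)
      qed
    qed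
  qed (auto simp: sandwich_mult sandwich_closed s0)
  moreover have "tensor_relations R (opposite_ring R) \<subseteq> ?I"
  proof
    fix u assume u: "u \<in> tensor_relations R (opposite_ring R)"
    then have "u \<in> carrier ?F"
      using tensor_relations_subset[OF ring_axioms opposite_ring_is_ring[OF ring_axioms]] by auto
    moreover have "sandwich R u x = \<zero>" if x: "x \<in> carrier R" for x
      using u unfolding tensor_relations_def
    proof (elim UnE CollectE exE conjE)
      fix a a' b
      assume *: "u = frag_of (a \<oplus> a', b) - frag_of (a, b) - frag_of (a', b)"
        "a \<in> carrier R" "a' \<in> carrier R" "b \<in> carrier (opposite_ring R)"
      then have b: "b \<in> carrier R" by (simp add: opposite_ring_def)
      have m: "a \<otimes> x \<otimes> b \<in> carrier R" "a' \<otimes> x \<otimes> b \<in> carrier R" using * b x by auto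
      have "sandwich R u x = (a \<oplus> a') \<otimes> x \<otimes> b \<ominus> a \<otimes> x \<otimes> b \<ominus> a' \<otimes> x \<otimes> b"
        using * b x
        by (simp add: sandwich_diff sandwich_frag_of formal_envelope_diff_closed gen)
      also have "\<dots> = \<zero>"
        using * b x m by (simp add: l_distr) algebra
      finally show ?thesis .
    next
      fix a b b'
      assume *: "u = frag_of (a, b \<oplus>\<^bsub>opposite_ring R\<^esub> b') - frag_of (a, b) - frag_of (a, b')"
        "a \<in> carrier R" "b \<in> carrier (opposite_ring R)" "b' \<in> carrier (opposite_ring R)"
      then have b: "b \<in> carrier R" "b' \<in> carrier R"
        and u_eq: "u = frag_of (a, b \<oplus> b') - frag_of (a, b) - frag_of (a, b')"
        by (simp_all add: opposite_ring_def)
      have m: "a \<otimes> x \<otimes> b \<in> carrier R" "a \<otimes> x \<otimes> b' \<in> carrier R" using * b x by auto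
      have "sandwich R u x = a \<otimes> x \<otimes> (b \<oplus> b') \<ominus> a \<otimes> x \<otimes> b \<ominus> a \<otimes> x \<otimes> b'"
        unfolding u_eq using *(2) b x
        by (simp add: sandwich_diff sandwich_frag_of formal_envelope_diff_closed gen)
      also have "\<dots> = \<zero>"
        using * b x m by (simp add: r_distr) algebra
      finally show ?thesis .
    qed
    ultimately show "u \<in> ?I" by auto
  qed
  ultimately have "Idl\<^bsub>?F\<^esub> (tensor_relations R (opposite_ring R)) \<subseteq> ?I"
    by (rule F.genideal_minimal)
  then show ?thesis using assms by auto
qed

end

lemma carrier_tensor_ring:
  "carrier (tensor_ring R S) =
    {Idl\<^bsub>formal_tensor_ring R S\<^esub> (tensor_relations R S) +>\<^bsub>formal_tensor_ring R S\<^esub> f | f.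
       f \<in> carrier (formal_tensor_ring R S)}"
  by (auto simp: tensor_ring_def FactRing_def A_RCOSETS_def' a_r_coset_def')

lemma smult_two_sided_module:
  fixes R :: "'a ring"
  defines "F \<equiv> formal_tensor_ring R (opposite_ring R)"
  assumes "ring R" and f: "f \<in> carrier F" and x: "x \<in> carrier R"
  shows "(Idl\<^bsub>F\<^esub> (tensor_relations R (opposite_ring R)) +>\<^bsub>F\<^esub> f)
    \<odot>\<^bsub>two_sided_module R\<^esub> x = sandwich R f x"
proof -
  interpret ring R by fact
  interpret F: ring F unfolding F_def
    by (intro formal_tensor_ring_is_ring opposite_ring_is_ring ring_axioms)
  let ?I = "Idl\<^bsub>F\<^esub> (tensor_relations R (opposite_ring R))"
  interpret I: ideal ?I F
    using tensor_relations_subset[OF ring_axioms opposite_ring_is_ring[OF ring_axioms]]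
    by (intro F.genideal_ideal) (simp add: F_def)
  have "sandwich R g x = sandwich R f x" if g: "g \<in> ?I +>\<^bsub>F\<^esub> f" for g
  proof -
    obtain h where h: "h \<in> ?I" "g = h \<oplus>\<^bsub>F\<^esub> f"
      using g by (auto simp: a_r_coset_def'[of F])
    then have "g = h + f" by (simp add: F_def formal_tensor_ring_def)
    then show ?thesis
      using sandwich_add[of h f x] sandwich_relations[of h x] sandwich_closed[of f x]
        h(1) I.a_Hcarr[OF h(1)] f x
      unfolding F_def by simp
  qed
  moreover have "f \<in> ?I +>\<^bsub>F\<^esub> f"
    using f by (rule I.a_rcos_self)
  ultimately have "(\<lambda>g. sandwich R g x) ` (?I +>\<^bsub>F\<^esub> f) = {sandwich R f x}"
    by blast
  then show ?thesis
    by (simp add: two_sided_module_def)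
qed

lemma two_sided_module_is_left_module:
  fixes R :: "'a ring"
  assumes "ring R"
  shows "left_module (tensor_ring R (opposite_ring R)) (two_sided_module R)"
proof -
  interpret ring R by fact
  let ?F = "formal_tensor_ring R (opposite_ring R)"
  let ?I = "Idl\<^bsub>?F\<^esub> (tensor_relations R (opposite_ring R))"
  let ?T = "tensor_ring R (opposite_ring R)" and ?M = "two_sided_module R"
  interpret F: ring ?F
    by (intro formal_tensor_ring_is_ring opposite_ring_is_ring ring_axioms)
  interpret I: ideal ?I ?F
    using tensor_relations_subset[OF ring_axioms opposite_ring_is_ring[OF ring_axioms]]
    by (intro F.genideal_ideal)
  interpret q: ring_hom_ring ?F ?T "(+>\<^bsub>?F\<^esub>) ?I"
    unfolding tensor_ring_def by (rule I.rcos_ring_hom_ring)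
  have repr: "\<exists>f\<in>carrier ?F. t = ?I +>\<^bsub>?F\<^esub> f" if "t \<in> carrier ?T" for t
    using that by (auto simp: carrier_tensor_ring)
  have M: "carrier ?M = carrier R" "add ?M = add R"
    by (simp_all add: two_sided_module_def)
  note act = smult_two_sided_module[OF \<open>ring R\<close>]
  have add: "f \<oplus>\<^bsub>?F\<^esub> g = f + g" for f g
    by (simp add: formal_tensor_ring_def)
  have "abelian_group ?M"
    by (rule abelian_groupI)
       (auto simp: two_sided_module_def a_ac intro!: bexI[of _ "\<ominus>\<^bsub>R\<^esub> _"] l_neg)
  moreover have "left_module_axioms ?T ?M"
  proof
    fix s t x y
    assume s: "s \<in> carrier ?T" and x: "x \<in> carrier ?M"
    obtain f where f: "f \<in> carrier ?F" "s = ?I +>\<^bsub>?F\<^esub> f" using repr[OF s] by auto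
    show "s \<odot>\<^bsub>?M\<^esub> x \<in> carrier ?M"
      using f x by (simp add: act M sandwich_closed)
    show "s \<odot>\<^bsub>?M\<^esub> (x \<oplus>\<^bsub>?M\<^esub> y) = s \<odot>\<^bsub>?M\<^esub> x \<oplus>\<^bsub>?M\<^esub> s \<odot>\<^bsub>?M\<^esub> y"
      if "y \<in> carrier ?M"
      using f x that by (simp add: act M sandwich_r_add)
    assume t: "t \<in> carrier ?T"
    obtain g where g: "g \<in> carrier ?F" "t = ?I +>\<^bsub>?F\<^esub> g" using repr[OF t] by auto
    have "s \<oplus>\<^bsub>?T\<^esub> t = ?I +>\<^bsub>?F\<^esub> (f \<oplus>\<^bsub>?F\<^esub> g)"
      using f g by simp
    then have "(s \<oplus>\<^bsub>?T\<^esub> t) \<odot>\<^bsub>?M\<^esub> x = sandwich R (f + g) x"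
      using f g x F.a_closed[of f g] by (simp add: act M add del: q.hom_add)
    then show "(s \<oplus>\<^bsub>?T\<^esub> t) \<odot>\<^bsub>?M\<^esub> x = s \<odot>\<^bsub>?M\<^esub> x \<oplus>\<^bsub>?M\<^esub> t \<odot>\<^bsub>?M\<^esub> x"
      using f g x by (simp add: act M sandwich_add)
    have "s \<otimes>\<^bsub>?T\<^esub> t = ?I +>\<^bsub>?F\<^esub> (f \<otimes>\<^bsub>?F\<^esub> g)"
      using f g by simp
    then have "(s \<otimes>\<^bsub>?T\<^esub> t) \<odot>\<^bsub>?M\<^esub> x = sandwich R (f \<otimes>\<^bsub>?F\<^esub> g) x"
      using f g x F.m_closed[of f g] by (simp add: act M del: q.hom_mult)
    then show "(s \<otimes>\<^bsub>?T\<^esub> t) \<odot>\<^bsub>?M\<^esub> x = s \<odot>\<^bsub>?M\<^esub> (t \<odot>\<^bsub>?M\<^esub> x)"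
      using f g x by (simp add: act M sandwich_mult sandwich_closed)
  next
    fix x assume x: "x \<in> carrier ?M"
    have one: "\<one>\<^bsub>?F\<^esub> = frag_of (\<one>\<^bsub>R\<^esub>, \<one>\<^bsub>R\<^esub>)"
      by (simp add: formal_tensor_ring_def opposite_ring_def)
    have "\<one>\<^bsub>?T\<^esub> = ?I +>\<^bsub>?F\<^esub> frag_of (\<one>\<^bsub>R\<^esub>, \<one>\<^bsub>R\<^esub>)"
      using one by (simp add: tensor_ring_def FactRing_def)
    moreover have "frag_of (\<one>\<^bsub>R\<^esub>, \<one>\<^bsub>R\<^esub>) \<in> carrier ?F"
      by (simp add: carrier_formal_envelope keys_frag_of)
    ultimately show "\<one>\<^bsub>?T\<^esub> \<odot>\<^bsub>?M\<^esub> x = x"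
      using x by (simp add: act M sandwich_frag_of)
  qed
  ultimately show ?thesis
    using q.S.ring_axioms by (intro left_module.intro)
qed

text \<open>Over a commutative ring, in particular a field, two-sided linearity is ordinary linearity.\<close>

lemma two_sided_module_commutative:
  fixes R :: "'a ring" (structure)
  assumes "cring R"
  shows "{\<lambda>x\<in>carrier R. t \<odot>\<^bsub>two_sided_module R\<^esub> x | t. t \<in> carrier (tensor_ring R (opposite_ring R))}
    = {\<lambda>x\<in>carrier R. c \<otimes>\<^bsub>R\<^esub> x | c. c \<in> carrier R}"
proof -
  interpret cring R by fact
  let ?F = "formal_tensor_ring R (opposite_ring R)"
  let ?I = "Idl\<^bsub>?F\<^esub> (tensor_relations R (opposite_ring R))"
  let ?T = "tensor_ring R (opposite_ring R)" and ?M = "two_sided_module R"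
  note act = smult_two_sided_module[OF ring_axioms]
  have "\<exists>c\<in>carrier R. \<forall>x\<in>carrier R. sandwich R f x = c \<otimes> x" if f: "f \<in> carrier ?F" for f
  proof (intro bexI ballI)
    let ?c = "\<Oplus>p\<in>Poly_Mapping.keys f. [Poly_Mapping.lookup f p] \<cdot> (fst p \<otimes> snd p)"
    have k: "Poly_Mapping.keys f \<subseteq> carrier R \<times> carrier R"
      using f by (simp add: carrier_formal_envelope)
    then show "?c \<in> carrier R" by (intro finsum_closed) auto
    fix x assume x: "x \<in> carrier R"
    have "[Poly_Mapping.lookup f p] \<cdot> (fst p \<otimes> x \<otimes> snd p) =
        [Poly_Mapping.lookup f p] \<cdot> (fst p \<otimes> snd p) \<otimes> x"
      if "p \<in> Poly_Mapping.keys f" for p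
    proof -
      have "fst p \<in> carrier R" "snd p \<in> carrier R" using that k by auto
      then show ?thesis using x by (simp add: add_pow_ldistr_int add_pow_rdistr_int m_ac)
    qed
    then show "sandwich R f x = ?c \<otimes> x"
      unfolding sandwich_def using k x
      by (subst finsum_ldistr) (auto intro!: finsum_cong')
  qed
  then have 1: "\<exists>c\<in>carrier R. \<forall>x\<in>carrier R. t \<odot>\<^bsub>?M\<^esub> x = c \<otimes> x" if "t \<in> carrier ?T" for t
    using that by (auto simp: carrier_tensor_ring act)
  have 2: "\<exists>t\<in>carrier ?T. \<forall>x\<in>carrier R. t \<odot>\<^bsub>?M\<^esub> x = c \<otimes> x" if c: "c \<in> carrier R" for c
  proof (intro bexI ballI)
    have f: "frag_of (c, \<one>) \<in> carrier ?F"
      using c by (simp add: carrier_formal_envelope keys_frag_of)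
    then show "?I +>\<^bsub>?F\<^esub> frag_of (c, \<one>) \<in> carrier ?T"
      by (auto simp: carrier_tensor_ring)
    show "(?I +>\<^bsub>?F\<^esub> frag_of (c, \<one>)) \<odot>\<^bsub>?M\<^esub> x = c \<otimes> x" if "x \<in> carrier R" for x
      using f c that by (simp add: act sandwich_frag_of)
  qed
  show ?thesis
  proof (intro equalityI subsetI; elim CollectE exE conjE)
    fix h t assume h: "h = (\<lambda>x\<in>carrier R. t \<odot>\<^bsub>?M\<^esub> x)" "t \<in> carrier ?T"
    obtain c where "c \<in> carrier R" "\<forall>x\<in>carrier R. t \<odot>\<^bsub>?M\<^esub> x = c \<otimes> x" using 1 h by blast
    then show "h \<in> {\<lambda>x\<in>carrier R. c \<otimes> x | c. c \<in> carrier R}"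
      using h by (auto intro!: exI[of _ c] restrict_ext)
  next
    fix h c assume h: "h = (\<lambda>x\<in>carrier R. c \<otimes> x)" "c \<in> carrier R"
    obtain t where "t \<in> carrier ?T" "\<forall>x\<in>carrier R. t \<odot>\<^bsub>?M\<^esub> x = c \<otimes> x" using 2 h by blast
    then show "h \<in> {\<lambda>x\<in>carrier R. t \<odot>\<^bsub>?M\<^esub> x | t. t \<in> carrier ?T}"
      using h by (auto intro!: exI[of _ t] restrict_ext)
  qed
qed


section \<open>Networks and codes\<close>

text \<open>The message vectors are numbered \<open>0, \<dots>, message_count N - 1\<close>.\<close>

record ('v, 'e) network =
  graph :: "('v, 'e) pre_digraph"
  sources :: "'v set"
  receivers :: "'v set"
  message_count :: nat
  origin :: "nat \<Rightarrow> 'v"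
  demands :: "'v \<Rightarrow> nat set"

locale network = fin_digraph "graph N" for N :: "('v, 'e) network" +
  assumes acyclic_graph: "acyclic (arcs_ends (graph N))"
    and sources_verts: "sources N \<subseteq> verts (graph N)"
    and receivers_verts: "receivers N \<subseteq> verts (graph N)"
    and origin_source: "i < message_count N \<Longrightarrow> origin N i \<in> sources N"
    and demands_messages: "v \<in> receivers N \<Longrightarrow> demands N v \<subseteq> {..<message_count N}"

datatype 'e signal = Message nat | Carried 'e

definition node_signals :: "('v, 'e) network \<Rightarrow> 'v \<Rightarrow> 'e signal set" where
  "node_signals N v =
    Message ` {i. i < message_count N \<and> origin N i = v} \<union> Carried ` in_arcs (graph N) v"

definition network_signals :: "('v, 'e) network \<Rightarrow> 'e signal set" where
  "network_signals N = Message ` {..<message_count N} \<union> Carried ` arcs (graph N)"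

definition vectors :: "'a set \<Rightarrow> nat \<Rightarrow> (nat \<Rightarrow> 'a) set" where
  "vectors A l = {..<l} \<rightarrow>\<^sub>E A"

fun signal_length :: "(nat \<Rightarrow> nat) \<Rightarrow> nat \<Rightarrow> 'e signal \<Rightarrow> nat" where
  "signal_length k n (Message i) = k i"
| "signal_length k n (Carried e) = n"

definition node_inputs ::
    "('v, 'e) network \<Rightarrow> 'a set \<Rightarrow> (nat \<Rightarrow> nat) \<Rightarrow> nat \<Rightarrow> 'v \<Rightarrow> ('e signal \<Rightarrow> nat \<Rightarrow> 'a) set" where
  "node_inputs N A k n v =
    (\<Pi>\<^sub>E s\<in>node_signals N v. vectors A (signal_length k n s))"

record ('v, 'e, 'a) code =
  edge_fun :: "'e \<Rightarrow> ('e signal \<Rightarrow> nat \<Rightarrow> 'a) \<Rightarrow> nat \<Rightarrow> 'a"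
  decoding_fun :: "'v \<Rightarrow> nat \<Rightarrow> ('e signal \<Rightarrow> nat \<Rightarrow> 'a) \<Rightarrow> nat \<Rightarrow> 'a"

definition is_code ::
    "('v, 'e) network \<Rightarrow> 'a set \<Rightarrow> (nat \<Rightarrow> nat) \<Rightarrow> nat \<Rightarrow> ('v, 'e, 'a) code \<Rightarrow> bool" where
  "is_code N A k n C \<longleftrightarrow>
    finite A \<and> 2 \<le> card A \<and> 1 \<le> n \<and>
    (\<forall>e\<in>arcs (graph N).
       edge_fun C e \<in> node_inputs N A k n (tail (graph N) e) \<rightarrow> vectors A n) \<and>
    (\<forall>v\<in>receivers N. \<forall>i\<in>demands N v.
       decoding_fun C v i \<in> node_inputs N A k n v \<rightarrow> vectors A (k i))"

text \<open>\<open>transmission N C x z\<close>: when the message vectors take the values \<open>x\<close>, each signal of the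
  network takes the value given by \<open>z\<close>.  As the graph is finite and acyclic, \<open>z\<close> exists and is
  unique (lemma \<open>transmission_unique\<close> below).\<close>

definition transmission ::
    "('v, 'e) network \<Rightarrow> ('v, 'e, 'a) code \<Rightarrow> (nat \<Rightarrow> nat \<Rightarrow> 'a) \<Rightarrow> ('e signal \<Rightarrow> nat \<Rightarrow> 'a) \<Rightarrow> bool"
  where
  "transmission N C x z \<longleftrightarrow>
    z \<in> extensional (network_signals N) \<and>
    (\<forall>i<message_count N. z (Message i) = x i) \<and>
    (\<forall>e\<in>arcs (graph N).
       z (Carried e) = edge_fun C e (restrict z (node_signals N (tail (graph N) e))))"

definition is_solution ::
    "('v, 'e) network \<Rightarrow> 'a set \<Rightarrow> (nat \<Rightarrow> nat) \<Rightarrow> nat \<Rightarrow> ('v, 'e, 'a) code \<Rightarrow> bool" where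
  "is_solution N A k n C \<longleftrightarrow>
    is_code N A k n C \<and>
    (\<forall>x \<in> (\<Pi>\<^sub>E i\<in>{..<message_count N}. vectors A (k i)). \<forall>z. transmission N C x z \<longrightarrow>
       (\<forall>v\<in>receivers N. \<forall>i\<in>demands N v.
          decoding_fun C v i (restrict z (node_signals N v)) = x i))"

lemma (in network) transmission_unique: "\<exists>!z. transmission N C x z"
proof -
  let ?G = "graph N"
  define rel where "rel = {(e', e). e' \<in> arcs ?G \<and> e \<in> arcs ?G \<and> head ?G e' = tail ?G e}"
  have "acyclic rel"
  proof -
    have "(tail ?G e', tail ?G e) \<in> (arcs_ends ?G)\<^sup>+" if "(e', e) \<in> rel\<^sup>+" for e' e
      using that
    proof (induction rule: trancl_induct)
      case (base e)
      then have "(tail ?G e', tail ?G e) \<in> arcs_ends ?G"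
        by (force simp: rel_def arcs_ends_conv)
      then show ?case by blast
    next
      case (step e f)
      then have "(tail ?G e, tail ?G f) \<in> arcs_ends ?G"
        by (force simp: rel_def arcs_ends_conv)
      with step.IH show ?case by (rule trancl_into_trancl)
    qed
    then show ?thesis
      using acyclic_graph unfolding acyclic_def by blast
  qed
  moreover have "finite rel"
    by (rule finite_subset[of _ "arcs ?G \<times> arcs ?G"]) (auto simp: rel_def)
  ultimately have wf: "wf rel" by (rule finite_acyclic_wf[rotated])
  define step where "step g e = edge_fun C e
      (\<lambda>s\<in>node_signals N (tail ?G e). case s of Message i \<Rightarrow> x i | Carried e' \<Rightarrow> g e')" for g e
  have step_cong: "step g e = step h e"
    if "e \<in> arcs ?G" "\<And>e'. (e', e) \<in> rel \<Longrightarrow> g e' = h e'" for g h e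
  proof -
    have "(case s of Message i \<Rightarrow> x i | Carried e' \<Rightarrow> g e') =
        (case s of Message i \<Rightarrow> x i | Carried e' \<Rightarrow> h e')"
      if "s \<in> node_signals N (tail ?G e)" for s
      using that \<open>e \<in> arcs ?G\<close> \<open>\<And>e'. (e', e) \<in> rel \<Longrightarrow> g e' = h e'\<close>
      by (auto simp: node_signals_def rel_def)
    then show ?thesis
      unfolding step_def by (metis (no_types, lifting) restrict_ext)
  qed
  define w where "w = wfrec rel step"
  have w: "w e = step w e" if "e \<in> arcs ?G" for e
    unfolding w_def by (subst wfrec[OF wf]) (rule step_cong[OF that], simp add: cut_def)
  have node_sub: "node_signals N v \<subseteq> network_signals N" for v
    by (auto simp: node_signals_def network_signals_def)
  define z where "z = (\<lambda>s\<in>network_signals N. case s of Message i \<Rightarrow> x i | Carried e \<Rightarrow> w e)"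
  have "transmission N C x z"
    unfolding transmission_def
  proof (intro conjI allI ballI impI)
    fix e assume e: "e \<in> arcs ?G"
    have "restrict z (node_signals N (tail ?G e)) =
        (\<lambda>s\<in>node_signals N (tail ?G e). case s of Message i \<Rightarrow> x i | Carried e \<Rightarrow> w e)"
      using node_sub by (auto simp: z_def restrict_def fun_eq_iff)
    then show "z (Carried e) = edge_fun C e (restrict z (node_signals N (tail ?G e)))"
      using e w[OF e] by (simp add: z_def step_def network_signals_def)
  qed (auto simp: z_def network_signals_def)
  moreover have "y = z" if y: "transmission N C x y" for y
  proof -
    have "y (Carried e) = w e" if "e \<in> arcs ?G" for e
      using wf that
    proof (induction e rule: wf_induct_rule)
      case (less e)
      have "restrict y (node_signals N (tail ?G e)) =
          (\<lambda>s\<in>node_signals N (tail ?G e). case s of Message i \<Rightarrow> x i | Carried e \<Rightarrow> y (Carried e))"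
        using y by (auto simp: transmission_def node_signals_def restrict_def fun_eq_iff)
      then have "y (Carried e) = step (\<lambda>e. y (Carried e)) e"
        using y less.prems by (simp add: transmission_def step_def)
      also have "\<dots> = step w e"
        using less.prems by (rule step_cong) (use less.IH rel_def in auto)
      finally show ?case using w less.prems by simp
    qed
    then show ?thesis
      using y by (intro extensionalityI[of _ "network_signals N"])
        (auto simp: transmission_def z_def network_signals_def)
  qed
  ultimately show ?thesis by blast
qed


section \<open>Linear codes\<close>

text \<open>The positions in the concatenation of the input vectors of a node are indexed by pairs of an
  input signal and a position in it, so that no order on the signals has to be chosen.\<close>

definition input_positions ::
    "('v, 'e) network \<Rightarrow> (nat \<Rightarrow> nat) \<Rightarrow> nat \<Rightarrow> 'v \<Rightarrow> ('e signal \<times> nat) set" where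
  "input_positions N k n v = (SIGMA s:node_signals N v. {..<signal_length k n s})"

definition linear_map ::
    "('r, 'm) ring_scheme \<Rightarrow> ('r, 'g) module \<Rightarrow> ('v, 'e) network \<Rightarrow> (nat \<Rightarrow> nat) \<Rightarrow> nat \<Rightarrow> 'v
      \<Rightarrow> nat \<Rightarrow> (('e signal \<Rightarrow> nat \<Rightarrow> 'g) \<Rightarrow> nat \<Rightarrow> 'g) \<Rightarrow> bool" where
  "linear_map R G N k n v l f \<longleftrightarrow>
    (\<exists>A \<in> {..<l} \<rightarrow> input_positions N k n v \<rightarrow> carrier R.
       \<forall>z \<in> node_inputs N (carrier G) k n v.
         f z = (\<lambda>r\<in>{..<l}. \<Oplus>\<^bsub>G\<^esub>c\<in>input_positions N k n v.
                  A r c \<odot>\<^bsub>G\<^esub> z (fst c) (snd c)))"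

definition linear_solution_over_module ::
    "('v, 'e) network \<Rightarrow> ('r, 'm) ring_scheme \<Rightarrow> ('r, 'g) module \<Rightarrow> (nat \<Rightarrow> nat) \<Rightarrow> nat
      \<Rightarrow> ('v, 'e, 'g) code \<Rightarrow> bool" where
  "linear_solution_over_module N R G k n C \<longleftrightarrow>
    is_solution N (carrier G) k n C \<and>
    (\<forall>e\<in>arcs (graph N). linear_map R G N k n (tail (graph N) e) n (edge_fun C e)) \<and>
    (\<forall>v\<in>receivers N. \<forall>i\<in>demands N v. linear_map R G N k n v (k i) (decoding_fun C v i))"

definition asymptotically_linearly_solvable_over_module ::
    "('v, 'e) network \<Rightarrow> ('r, 'm) ring_scheme \<Rightarrow> ('r, 'g) module \<Rightarrow> bool" where
  "asymptotically_linearly_solvable_over_module N R G \<longleftrightarrow>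
    (\<forall>\<epsilon>::rat. 0 < \<epsilon> \<and> \<epsilon> < 1 \<longrightarrow>
       (\<exists>k n C. linear_solution_over_module N R G k n C \<and>
          (\<forall>i<message_count N. of_nat (k i) / of_nat n = 1 - \<epsilon>)))"

definition asymptotically_linearly_solvable_over_ring :: "('v, 'e) network \<Rightarrow> 'a ring \<Rightarrow> bool" where
  "asymptotically_linearly_solvable_over_ring N R \<longleftrightarrow>
    asymptotically_linearly_solvable_over_module N
      (tensor_ring R (opposite_ring R)) (two_sided_module R)"

end

theory Submission
  imports Defs "HOL-Number_Theory.Cong"
begin

text \<open>Choose a prime \<open>p\<close> such that the finite module \<open>G\<close> has an element of order \<open>p\<close>.  The
  \<open>p\<close>-torsion elements form a non-zero submodule \<open>S\<close>, to which every linear solution restricts.  As a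
  group \<open>S\<close> is isomorphic to \<open>F\<^sub>p ^ d\<close>, and every scalar acts additively, hence
  \<open>F\<^sub>p\<close>-linearly, on \<open>S\<close>.  Replacing each symbol from \<open>S\<close> by its \<open>d\<close> coordinates multiplies all
  block sizes by \<open>d\<close> and so preserves the rate vector.\<close>

section \<open>Prime fields\<close>

text \<open>The integers modulo \<open>p\<close>, carried by natural numbers so that coordinates are
  plain naturals and congruences transfer directly. Writing \<open>1 mod p\<close> keeps the unit in
  the carrier even for \<open>p = 1\<close>.\<close>

definition nat_residue_ring :: "nat \<Rightarrow> nat ring" where
  "nat_residue_ring p =
    \<lparr>carrier = {..<p}, monoid.mult = \<lambda>x y. x * y mod p, monoid.one = 1 mod p,
     ring.zero = 0, ring.add = \<lambda>x y. (x + y) mod p\<rparr>"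

lemma nat_residue_ring_simps [simp]:
  "carrier (nat_residue_ring p) = {..<p}"
  "x \<otimes>\<^bsub>nat_residue_ring p\<^esub> y = x * y mod p"
  "\<one>\<^bsub>nat_residue_ring p\<^esub> = 1 mod p"
  "\<zero>\<^bsub>nat_residue_ring p\<^esub> = 0"
  "x \<oplus>\<^bsub>nat_residue_ring p\<^esub> y = (x + y) mod p"
  by (simp_all add: nat_residue_ring_def)

lemma nat_residue_ring_cring:
  assumes "0 < p"
  shows "cring (nat_residue_ring p)"
proof (rule cringI)
  show "abelian_group (nat_residue_ring p)"
  proof (rule abelian_groupI)
    fix x assume "x \<in> carrier (nat_residue_ring p)"
    then show "\<exists>y\<in>carrier (nat_residue_ring p).
        y \<oplus>\<^bsub>nat_residue_ring p\<^esub> x = \<zero>\<^bsub>nat_residue_ring p\<^esub>"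
      using assms by (intro bexI[of _ "(p - x) mod p"]) (auto simp: mod_add_left_eq)
  qed (use assms in \<open>auto simp: mod_simps algebra_simps\<close>)
  show "comm_monoid (nat_residue_ring p)"
    by (rule comm_monoidI) (use assms in \<open>auto simp: mod_simps algebra_simps\<close>)
qed (use assms in \<open>auto simp: mod_simps algebra_simps\<close>)

text \<open>Non-zero residues are coprime to the prime \<open>p\<close>, and solving
  \<open>a * x = 1\<close> modulo \<open>p\<close> inverts them.\<close>

lemma nat_residue_ring_field:
  assumes "Factorial_Ring.prime p"
  shows "field (nat_residue_ring p)"
proof -
  have p: "1 < p" using assms by (rule prime_gt_1_nat)
  interpret cring "nat_residue_ring p" using p by (intro nat_residue_ring_cring) simp
  show ?thesis
  proof (rule cring_fieldI2)
    fix a assume "a \<in> carrier (nat_residue_ring p)" "a \<noteq> \<zero>\<^bsub>nat_residue_ring p\<^esub>"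
    then have "coprime a p"
      using assms by (metis bot_nat_0.not_eq_extremum coprime_commute lessThan_iff
          nat_dvd_not_less nat_residue_ring_simps(1,4) prime_imp_coprime_nat)
    then obtain x where "[a * x = 1] (mod p)" using cong_solve_coprime_nat by auto
    then show "\<exists>b\<in>carrier (nat_residue_ring p).
        a \<otimes>\<^bsub>nat_residue_ring p\<^esub> b = \<one>\<^bsub>nat_residue_ring p\<^esub>"
      using p by (intro bexI[of _ "x mod p"]) (auto simp: cong_def mod_simps)
  qed (use p in simp)
qed

text \<open>Reducing once at the end gives the same residue as reducing after each addition, so
  field sums can be compared with congruences between sums of naturals.\<close>

lemma finsum_nat_residue_ring:
  assumes "0 < p" "finite A" "f \<in> A \<rightarrow> {..<p}"
  shows "finsum (nat_residue_ring p) f A = (\<Sum>a\<in>A. f a) mod p"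
proof -
  interpret cring "nat_residue_ring p" by (rule nat_residue_ring_cring) fact
  show ?thesis
    using assms(2,3) by (induction A rule: finite_induct) (auto simp: Pi_iff mod_simps)
qed

section \<open>Ordinary scalars inside the two-sided module\<close>

lemma finsum_two_sided_module: "finsum (two_sided_module R) = finsum R"
  by (simp add: fun_eq_iff finsum_def finprod_def two_sided_module_def)

text \<open>Linear codes over a ring take their matrix entries from the tensor ring. For commutative
  \<open>K\<close> this turns an ordinary scalar into such an entry.\<close>

lemma two_sided_scalar:
  assumes "cring K" "c \<in> carrier K"
  obtains t where "t \<in> carrier (tensor_ring K (opposite_ring K))"
    "\<And>x. x \<in> carrier K \<Longrightarrow> t \<odot>\<^bsub>two_sided_module K\<^esub> x = c \<otimes>\<^bsub>K\<^esub> x"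
proof -
  have "(\<lambda>x\<in>carrier K. c \<otimes>\<^bsub>K\<^esub> x) \<in>
      {\<lambda>x\<in>carrier K. t \<odot>\<^bsub>two_sided_module K\<^esub> x | t. t \<in> carrier (tensor_ring K (opposite_ring K))}"
    unfolding two_sided_module_commutative[OF assms(1)] using assms(2) by blast
  then obtain t where "t \<in> carrier (tensor_ring K (opposite_ring K))"
    "(\<lambda>x\<in>carrier K. c \<otimes>\<^bsub>K\<^esub> x) = (\<lambda>x\<in>carrier K. t \<odot>\<^bsub>two_sided_module K\<^esub> x)"
    by blast
  then show ?thesis
    by (intro that[of t]) (auto, metis (no_types, lifting) restrict_apply')
qed


section \<open>Elementary abelian groups\<close>

text \<open>Both follow by induction from the additivity of \<open>h\<close> modulo \<open>p\<close>
  on \<open>S\<close>. With \<open>h\<close> a coordinate they compute coordinates of multiples and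
  sums; with \<open>h\<close> constantly 0 and modulus 1 the congruences are void and only the
  closure of \<open>S\<close> remains.\<close>

lemma (in abelian_group)
  fixes h :: "'a \<Rightarrow> nat"
  assumes S: "S \<subseteq> carrier G" "\<zero> \<in> S" "\<And>x y. x \<in> S \<Longrightarrow> y \<in> S \<Longrightarrow> x \<oplus> y \<in> S"
    and h: "\<And>x y. x \<in> S \<Longrightarrow> y \<in> S \<Longrightarrow> [h (x \<oplus> y) = h x + h y] (mod p)"
  shows additive_cong_pow: "x \<in> S \<Longrightarrow> [n] \<cdot> x \<in> S \<and> [h ([n] \<cdot> x) = n * h x] (mod p)"
    and additive_cong_finsum: "finite A \<Longrightarrow> g \<in> A \<rightarrow> S \<Longrightarrow>
      finsum G g A \<in> S \<and> [h (finsum G g A) = (\<Sum>a\<in>A. h (g a))] (mod p)"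
proof -
  \<comment> \<open>Zero plus zero is zero, so \<open>h\<close> of it is congruent to its own
    double; cancel.\<close>
  have 0: "[h \<zero> = 0] (mod p)"
    using h[of \<zero> \<zero>] S by (metis add.l_one cong_add_lcancel_0_nat cong_sym subsetD)
  show "[n] \<cdot> x \<in> S \<and> [h ([n] \<cdot> x) = n * h x] (mod p)" if x: "x \<in> S"
  proof (induction n)
    case (Suc n)
    then have "[h ([n] \<cdot> x \<oplus> x) = n * h x + h x] (mod p)"
      using cong_trans[OF h cong_add[OF _ cong_refl]] x by blast
    then show ?case using Suc x S by (simp add: add.commute)
  qed (use S 0 in simp)
  show "finsum G g A \<in> S \<and> [h (finsum G g A) = (\<Sum>a\<in>A. h (g a))] (mod p)"
    if "finite A" "g \<in> A \<rightarrow> S"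
    using that
  proof (induction A rule: finite_induct)
    case (insert a A)
    then have A: "g a \<in> S" "finsum G g A \<in> S" "[h (finsum G g A) = (\<Sum>a\<in>A. h (g a))] (mod p)"
      by auto
    then have "[h (g a \<oplus> finsum G g A) = h (g a) + (\<Sum>a\<in>A. h (g a))] (mod p)"
      using cong_trans[OF h[OF A(1,2)] cong_add[OF cong_refl A(3)]] by blast
    moreover have "finsum G g (insert a A) = g a \<oplus> finsum G g A"
      using insert S by (intro finsum_insert) auto
    ultimately show ?case using insert S by auto
  qed (use S 0 in simp)
qed

text \<open>Coefficients are arbitrary naturals rather than residues, so that they can be added and
  scaled freely; reduction modulo \<open>p\<close> is a separate step,
  \<open>lincomb_mod\<close>.\<close>

definition lincomb :: "('a, 'm) ring_scheme \<Rightarrow> (nat \<Rightarrow> 'a) \<Rightarrow> nat \<Rightarrow> (nat \<Rightarrow> nat) \<Rightarrow> 'a" where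
  "lincomb G b d c = (\<Oplus>\<^bsub>G\<^esub>j\<in>{..<d}. [c j] \<cdot>\<^bsub>G\<^esub> b j)"

context abelian_group
begin

lemma lincomb_cong:
  "(\<And>j. j < d \<Longrightarrow> b j = b' j) \<Longrightarrow> (\<And>j. j < d \<Longrightarrow> c j = c' j) \<Longrightarrow> b' \<in> {..<d} \<rightarrow> carrier G \<Longrightarrow>
    lincomb G b d c = lincomb G b' d c'"
  unfolding lincomb_def by (intro finsum_cong') auto

lemma lincomb_closed: "b \<in> {..<d} \<rightarrow> carrier G \<Longrightarrow> lincomb G b d c \<in> carrier G"
  unfolding lincomb_def by (intro finsum_closed) auto

lemma lincomb_Suc:
  "b \<in> {..<Suc d} \<rightarrow> carrier G \<Longrightarrow> lincomb G b (Suc d) c = [c d] \<cdot> b d \<oplus> lincomb G b d c"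
  unfolding lincomb_def lessThan_Suc by (subst finsum_insert) (auto simp: Pi_iff)

lemma lincomb_add:
  assumes "b \<in> {..<d} \<rightarrow> carrier G"
  shows "lincomb G b d (\<lambda>j. c j + c' j) = lincomb G b d c \<oplus> lincomb G b d c'"
proof -
  have "[(c j + c' j)] \<cdot> b j = [c j] \<cdot> b j \<oplus> [c' j] \<cdot> b j" if "j < d" for j
    using assms that by (subst add.nat_pow_mult) auto
  then have "lincomb G b d (\<lambda>j. c j + c' j) =
      (\<Oplus>j\<in>{..<d}. [c j] \<cdot> b j \<oplus> [c' j] \<cdot> b j)"
    unfolding lincomb_def using assms by (intro finsum_cong') auto
  then show ?thesis
    unfolding lincomb_def using assms by (subst (asm) finsum_addf) auto
qed

lemma lincomb_mult:
  assumes "b \<in> {..<d} \<rightarrow> carrier G"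
  shows "[m] \<cdot> lincomb G b d c = lincomb G b d (\<lambda>j. m * c j)"
proof (induction m)
  case 0
  have "lincomb G b d (\<lambda>j. 0) = (\<Oplus>j\<in>{..<d}. \<zero>)"
    unfolding lincomb_def by (intro finsum_cong') auto
  then show ?case by simp
next
  case (Suc m)
  then show ?case
    using lincomb_add[OF assms, of "\<lambda>j. m * c j" c] by (simp add: add.commute)
qed

lemma pow_mod:
  assumes "x \<in> carrier G" "[(p::nat)] \<cdot> x = \<zero>"
  shows "[(m mod p)] \<cdot> x = [m] \<cdot> x"
proof -
  have "[m] \<cdot> x = [(p * (m div p))] \<cdot> x \<oplus> [(m mod p)] \<cdot> x"
    using add.nat_pow_mult[OF assms(1), of "p * (m div p)" "m mod p"] by simp
  also have "[(p * (m div p))] \<cdot> x = [(m div p)] \<cdot> ([p] \<cdot> x)"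
    using assms(1) by (simp add: add.nat_pow_pow)
  finally show ?thesis using assms by simp
qed

lemma lincomb_mod:
  assumes "b \<in> {..<d} \<rightarrow> carrier G" "\<And>j. j < d \<Longrightarrow> [(p::nat)] \<cdot> b j = \<zero>"
  shows "lincomb G b d (\<lambda>j\<in>{..<d}. c j mod p) = lincomb G b d c"
  unfolding lincomb_def using assms by (intro finsum_cong') (auto simp: pow_mod Pi_iff)

text \<open>A longest family with pairwise distinct linear combinations spans: otherwise it could be
  extended by an element outside its span, because non-zero residues are invertible.\<close>

lemma elementary_abelian_basis:
  assumes p: "Factorial_Ring.prime p" and fin: "finite S"
    and S: "S \<subseteq> carrier G" "\<zero> \<in> S" "\<And>x y. x \<in> S \<Longrightarrow> y \<in> S \<Longrightarrow> x \<oplus> y \<in> S"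
    and tors: "\<And>x. x \<in> S \<Longrightarrow> [p] \<cdot> x = \<zero>"
  obtains d b where "b \<in> {..<d} \<rightarrow> S" "bij_betw (lincomb G b d) (vectors {..<p} d) S"
proof -
  have p1: "1 < p" using p by (rule prime_gt_1_nat)
  define P where "P d \<longleftrightarrow> (\<exists>b. b \<in> {..<d} \<rightarrow> S \<and> inj_on (lincomb G b d) (vectors {..<p} d))" for d
  have S_pow: "[n] \<cdot> x \<in> S" if "x \<in> S" for x and n :: nat
    using additive_cong_pow[OF S, of "\<lambda>_. 0" 1] that by simp
  have S_comb: "lincomb G b d c \<in> S" if "b \<in> {..<d} \<rightarrow> S" for b d c
    unfolding lincomb_def
    using additive_cong_finsum[OF S, of "\<lambda>_. 0" 1 "{..<d}" "\<lambda>j. [c j] \<cdot> b j"] that S_pow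
    by (auto simp: Pi_iff)
  have "P 0" by (auto simp: P_def vectors_def)
  \<comment> \<open>Injectivity places \<open>p ^ d\<close> elements in the finite set
    \<open>S\<close>, and \<open>d < 2 ^ d \<le> p ^ d\<close> bounds \<open>d\<close>; so a largest
    such \<open>d\<close> exists.\<close>
  moreover have "d \<le> card S" if P: "P d" for d
  proof -
    obtain b where b: "b \<in> {..<d} \<rightarrow> S" "inj_on (lincomb G b d) (vectors {..<p} d)"
      using P unfolding P_def by blast
    have "p ^ d = card (vectors {..<p} d)" by (simp add: vectors_def card_PiE)
    also have "\<dots> \<le> card S"
      using b S_comb fin by (intro card_inj_on_le[of "lincomb G b d"]) auto
    finally show ?thesis
      using less_exp[of d] power_mono[of 2 p d] p1 by linarith
  qed
  ultimately obtain d where d: "P d" "\<And>e. P e \<Longrightarrow> e \<le> d"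
    by (metis (no_types, lifting) GreatestI_nat Greatest_le_nat)
  obtain b where b: "b \<in> {..<d} \<rightarrow> S" "inj_on (lincomb G b d) (vectors {..<p} d)"
    using d(1) unfolding P_def by blast
  have bG: "b \<in> {..<d} \<rightarrow> carrier G" using b(1) S by auto
  have modv: "(\<lambda>j\<in>{..<d}. c j mod p) \<in> vectors {..<p} d" for c :: "nat \<Rightarrow> nat"
    using p1 by (auto simp: vectors_def)
  have span: "lincomb G b d c \<in> lincomb G b d ` vectors {..<p} d" for c
  proof -
    have "lincomb G b d (\<lambda>j\<in>{..<d}. c j mod p) = lincomb G b d c"
      using tors b(1) by (intro lincomb_mod bG) auto
    then show ?thesis using imageI[OF modv, of "lincomb G b d" c] by simp
  qed
  have "y \<in> lincomb G b d ` vectors {..<p} d" if y: "y \<in> S" for y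
  proof (rule ccontr)
    assume ny: "y \<notin> lincomb G b d ` vectors {..<p} d"
    \<comment> \<open>Multiplying by an inverse \<open>x\<close> of \<open>m\<close> modulo
      \<open>p\<close> would put \<open>y\<close> itself into the span.\<close>
    have no: False if "0 < m" "m < p" "[(m::nat)] \<cdot> y = lincomb G b d c" for m c
    proof -
      have "coprime m p" using that p
        by (metis coprime_commute nat_dvd_not_less prime_imp_coprime_nat)
      then obtain x where x: "[m * x = 1] (mod p)" using cong_solve_coprime_nat by auto
      have yG: "y \<in> carrier G" using y S by auto
      have "[x] \<cdot> ([m] \<cdot> y) = [(m * x)] \<cdot> y" using yG by (simp add: add.nat_pow_pow)
      also have "\<dots> = [(m * x mod p)] \<cdot> y" using pow_mod[OF yG tors[OF y]] by simp
      also have "\<dots> = y" using x p1 yG by (simp add: cong_def)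
      finally have "y = lincomb G b d (\<lambda>j. x * c j)" using that(3) lincomb_mult[OF bG] by simp
      with ny span show False by metis
    qed
    define b' where "b' = b(d := y)"
    have b': "b' \<in> {..<Suc d} \<rightarrow> S" using b y by (auto simp: b'_def Pi_iff less_Suc_eq)
    have b'G: "b' \<in> {..<Suc d} \<rightarrow> carrier G" using b' S by auto
    have ex: "lincomb G b' (Suc d) c = [c d] \<cdot> y \<oplus> lincomb G b d c" for c
      using lincomb_Suc[OF b'G, of c] lincomb_cong[of d b' b c c] bG by (simp add: b'_def)
    have yG: "y \<in> carrier G" using y S by auto
    \<comment> \<open>Ordering the last coefficients makes their difference a natural number; the
      other case follows by symmetry.\<close>
    have le: "c d = c' d \<and> lincomb G b d c = lincomb G b d c'"
      if c: "c \<in> vectors {..<p} (Suc d)" "c' \<in> vectors {..<p} (Suc d)"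
        and eq: "lincomb G b' (Suc d) c = lincomb G b' (Suc d) c'" and le: "c d \<le> c' d" for c c'
    proof -
      let ?u = "lincomb G b d c" and ?v = "lincomb G b d c'"
      have uv: "?u \<in> carrier G" "?v \<in> carrier G" using lincomb_closed[OF bG] by auto
      have "[c' d] \<cdot> y = [c d] \<cdot> y \<oplus> [(c' d - c d)] \<cdot> y"
        using le yG by (simp add: add.nat_pow_mult)
      then have "[c d] \<cdot> y \<oplus> ?u = [c d] \<cdot> y \<oplus> ([(c' d - c d)] \<cdot> y \<oplus> ?v)"
        using eq ex yG uv by (simp add: a_assoc)
      then have 1: "?u = [(c' d - c d)] \<cdot> y \<oplus> ?v"
        by (rule add.l_cancel) (use yG uv in simp_all)
      \<comment> \<open>As \<open>p\<close> annihilates \<open>?v\<close>, its multiple by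
        \<open>p - 1\<close> is its negative; this expresses subtraction with natural
        coefficients.\<close>
      have v0: "?v \<oplus> [(p - 1)] \<cdot> ?v = \<zero>"
      proof -
        have "Suc (p - 1) = p" using p1 by simp
        then have "?v \<oplus> [(p - 1)] \<cdot> ?v = [p] \<cdot> ?v"
          using add.nat_pow_Suc2[OF uv(2), of "p - 1"] by argo
        then show ?thesis using tors[OF S_comb[OF b(1)], of c'] by argo
      qed
      have "?u \<oplus> [(p - 1)] \<cdot> ?v = [(c' d - c d)] \<cdot> y"
        unfolding 1 using v0 yG uv by (subst a_assoc) (simp_all del: One_nat_def)
      then have 2: "[(c' d - c d)] \<cdot> y = lincomb G b d (\<lambda>j. c j + (p - 1) * c' j)"
        using lincomb_add[OF bG, of c "\<lambda>j. (p - 1) * c' j"] lincomb_mult[OF bG, of "p - 1" c'] by simp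
      have "c' d < p" using c by (auto simp: vectors_def)
      \<comment> \<open>The difference of the two combinations is a multiple of \<open>y\<close>
        lying in the span, so by \<open>no\<close> the multiplier vanishes.\<close>
      then have "c' d = c d"
        using no[OF _ _ 2] le by (metis diff_is_0_eq le_antisym less_imp_diff_less neq0_conv)
      then show ?thesis using 1 uv by simp
    qed
    have "inj_on (lincomb G b' (Suc d)) (vectors {..<p} (Suc d))"
    proof (rule inj_onI)
      fix c c' assume c: "c \<in> vectors {..<p} (Suc d)" "c' \<in> vectors {..<p} (Suc d)"
        "lincomb G b' (Suc d) c = lincomb G b' (Suc d) c'"
      have *: "c d = c' d \<and> lincomb G b d c = lincomb G b d c'"
        using le[of c c'] le[of c' c] c by (metis nat_le_linear)
      \<comment> \<open>Coefficient vectors are extensional; cutting off position \<open>d\<close>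
        yields vectors of length \<open>d\<close>, to which the injectivity of the old family
        applies.\<close>
      have r: "lincomb G b d (restrict c {..<d}) = lincomb G b d c" for c
        using bG by (intro lincomb_cong) auto
      have "restrict c {..<d} = restrict c' {..<d}"
        using c * r by (intro inj_onD[OF b(2)]) (auto simp: vectors_def)
      then have "c j = c' j" if "j < Suc d" for j
        using * that by (metis lessThan_iff less_antisym restrict_apply')
      then show "c = c'"
        using c(1,2) unfolding vectors_def by (intro PiE_ext) auto
    qed
    then have "P (Suc d)" using b' P_def by blast
    then show False using d(2)[of "Suc d"] by simp
  qed
  then have "bij_betw (lincomb G b d) (vectors {..<p} d) S"
    using b S_comb by (auto simp: bij_betw_def)
  then show ?thesis using that b by blast
qed

text \<open>Let \<open>n\<close> be the additive order of a non-zero element and \<open>p\<close> a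
  prime factor of \<open>n\<close>, with \<open>n = m * p\<close>; then the \<open>m\<close>-fold
  multiple of that element has order \<open>p\<close>.\<close>

lemma exists_prime_torsion:
  assumes "finite (carrier G)" "2 \<le> card (carrier G)"
  obtains p x where "Factorial_Ring.prime p" "x \<in> carrier G" "x \<noteq> \<zero>" "[(p::nat)] \<cdot> x = \<zero>"
proof -
  obtain x where x: "x \<in> carrier G" "x \<noteq> \<zero>"
    using assms by (metis card_le_Suc0_iff_eq not_less_eq_eq numeral_2_eq_2 zero_closed)
  define n where "n = (LEAST n::nat. 0 < n \<and> [n] \<cdot> x = \<zero>)"
  \<comment> \<open>By Lagrange the order of the group annihilates \<open>x\<close>, so the least
    \<open>n\<close> exists.\<close>
  have "0 < card (carrier G) \<and> [card (carrier G)] \<cdot> x = \<zero>"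
    using add.pow_order_eq_1[OF x(1)] assms by (simp add: order_def)
  then have n: "0 < n \<and> [n] \<cdot> x = \<zero>" unfolding n_def by (rule LeastI)
  moreover have "n \<noteq> 1" using n x by auto
  ultimately obtain p m where p: "Factorial_Ring.prime p" "n = m * p"
    by (metis dvdE mult.commute prime_factor_nat)
  have "0 < m" "m < n" using n p prime_gt_1_nat[of p] by auto
  then have "[m] \<cdot> x \<noteq> \<zero>" using not_less_Least[of m] unfolding n_def by blast
  moreover have "[p] \<cdot> ([m] \<cdot> x) = \<zero>" using n p x by (simp add: add.nat_pow_pow)
  ultimately show ?thesis using that[of p "[m] \<cdot> x"] p x by simp
qed

end


section \<open>Expanding codes in coordinates\<close>

lemma node_inputs_value:
  assumes "z \<in> node_inputs N A k n v" "c \<in> input_positions N k n v"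
  shows "z (fst c) (snd c) \<in> A"
proof -
  have c: "fst c \<in> node_signals N v" "snd c \<in> {..<signal_length k n (fst c)}"
    using assms(2) by (auto simp: input_positions_def)
  show ?thesis
    using PiE_mem[OF PiE_mem[OF assms(1)[unfolded node_inputs_def vectors_def] c(1)] c(2)] .
qed

text \<open>\<open>basis_bij\<close> identifies the group \<open>S\<close> with the vector space of
  dimension \<open>d\<close> over the prime field. \<open>d_pos\<close> keeps the new block size
  \<open>n * d\<close> positive and makes \<open>div d\<close> and \<open>mod d\<close> split
  positions properly.\<close>

locale elementary_submodule = left_module R G
  for R :: "('r, 'm) ring_scheme" and G :: "('r, 'g) module" +
  fixes p d :: nat and b :: "nat \<Rightarrow> 'g" and S :: "'g set"
  assumes prime_p: "Factorial_Ring.prime p"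
    and sub_carrier: "S \<subseteq> carrier G"
    and sub_zero: "\<zero>\<^bsub>G\<^esub> \<in> S"
    and sub_add: "\<lbrakk>x \<in> S; y \<in> S\<rbrakk> \<Longrightarrow> x \<oplus>\<^bsub>G\<^esub> y \<in> S"
    and sub_smult: "\<lbrakk>a \<in> carrier R; x \<in> S\<rbrakk> \<Longrightarrow> a \<odot>\<^bsub>G\<^esub> x \<in> S"
    and torsion: "x \<in> S \<Longrightarrow> [p] \<cdot>\<^bsub>G\<^esub> x = \<zero>\<^bsub>G\<^esub>"
    and basis_sub: "b \<in> {..<d} \<rightarrow> S"
    and basis_bij: "bij_betw (lincomb G b d) (vectors {..<p} d) S"
    and d_pos: "0 < d"
begin

section \<open>Coordinates on the submodule\<close>

abbreviation K :: "nat ring" where "K \<equiv> nat_residue_ring p"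

definition coords :: "'g \<Rightarrow> nat \<Rightarrow> nat" where
  "coords = inv_into (vectors {..<p} d) (lincomb G b d)"

text \<open>Position \<open>t * d + j\<close> of the expansion holds coordinate \<open>j\<close> of
  symbol \<open>t\<close>; \<open>contract\<close> undoes this.\<close>

definition expand :: "nat \<Rightarrow> (nat \<Rightarrow> 'g) \<Rightarrow> nat \<Rightarrow> nat" where
  "expand l x = (\<lambda>q\<in>{..<l * d}. coords (x (q div d)) (q mod d))"

definition contract :: "nat \<Rightarrow> (nat \<Rightarrow> nat) \<Rightarrow> nat \<Rightarrow> 'g" where
  "contract l c = (\<lambda>t\<in>{..<l}. lincomb G b d (\<lambda>j. c (t * d + j)))"

lemma p_gt_1: "1 < p"
  using prime_p by (rule prime_gt_1_nat)

lemma basis_carrier: "b \<in> {..<d} \<rightarrow> carrier G"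
  using basis_sub sub_carrier by auto

lemmas sub_closed = sub_carrier sub_zero sub_add

lemma sub_pow: "x \<in> S \<Longrightarrow> [(n::nat)] \<cdot>\<^bsub>G\<^esub> x \<in> S"
  using M.additive_cong_pow[OF sub_closed, of "\<lambda>_. 0" 1] by simp

lemma sub_finsum: "finite A \<Longrightarrow> g \<in> A \<rightarrow> S \<Longrightarrow> finsum G g A \<in> S"
  using M.additive_cong_finsum[OF sub_closed, of "\<lambda>_. 0" 1] by simp

lemma lincomb_sub: "lincomb G b d c \<in> S"
  unfolding lincomb_def using basis_sub by (intro sub_finsum) (auto intro: sub_pow)

lemma coords_vectors: "x \<in> S \<Longrightarrow> coords x \<in> vectors {..<p} d"
  using basis_bij unfolding coords_def by (metis bij_betw_def inv_into_into)

lemma coords_less: "x \<in> S \<Longrightarrow> i < d \<Longrightarrow> coords x i < p"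
  using coords_vectors by (auto simp: vectors_def)

lemma lincomb_coords: "x \<in> S \<Longrightarrow> lincomb G b d (coords x) = x"
  using basis_bij unfolding coords_def by (metis bij_betw_def f_inv_into_f)

text \<open>The reduced coefficients form a vector in the domain of the bijection, and reducing does
  not change the combination because \<open>p\<close> annihilates the basis.\<close>

lemma coords_lincomb: "i < d \<Longrightarrow> coords (lincomb G b d c) i = c i mod p"
proof -
  assume i: "i < d"
  let ?c = "\<lambda>j\<in>{..<d}. c j mod p"
  have "?c \<in> vectors {..<p} d" using p_gt_1 by (auto simp: vectors_def)
  then have "coords (lincomb G b d ?c) = ?c"
    unfolding coords_def using basis_bij by (metis bij_betw_def inv_into_f_f)
  moreover have "lincomb G b d ?c = lincomb G b d c"
    using basis_sub torsion by (intro M.lincomb_mod basis_carrier) auto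
  ultimately show ?thesis using i by simp
qed

lemma coords_add:
  assumes "x \<in> S" "y \<in> S" "i < d"
  shows "[coords (x \<oplus>\<^bsub>G\<^esub> y) i = coords x i + coords y i] (mod p)"
proof -
  have "x \<oplus>\<^bsub>G\<^esub> y = lincomb G b d (\<lambda>j. coords x j + coords y j)"
    using assms by (simp add: M.lincomb_add[OF basis_carrier] lincomb_coords)
  then show ?thesis using assms(3) by (simp add: coords_lincomb cong_def)
qed

text \<open>Additivity of the action already makes it linear over the prime field. The factors of
  \<open>c j\<close> are the entries of the matrix of \<open>a\<close> in the basis
  \<open>b\<close>.\<close>

lemma coords_smult_lincomb:
  assumes a: "a \<in> carrier R" and i: "i < d"
  shows "[coords (a \<odot>\<^bsub>G\<^esub> lincomb G b d c) i = (\<Sum>j<d. coords (a \<odot>\<^bsub>G\<^esub> b j) i * c j)] (mod p)"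
proof -
  let ?h = "\<lambda>x. coords (a \<odot>\<^bsub>G\<^esub> x) i"
  have h: "[?h (x \<oplus>\<^bsub>G\<^esub> y) = ?h x + ?h y] (mod p)" if "x \<in> S" "y \<in> S" for x y
    using coords_add[OF sub_smult[OF a that(1)] sub_smult[OF a that(2)] i] that a sub_carrier
    by (simp add: smult_r_distr subset_iff)
  have "[?h (lincomb G b d c) = (\<Sum>j<d. ?h ([c j] \<cdot>\<^bsub>G\<^esub> b j))] (mod p)"
    unfolding lincomb_def
    using M.additive_cong_finsum[where h = ?h and A = "{..<d}", OF sub_closed h] basis_sub sub_pow
    by (auto simp: Pi_iff)
  also have "[(\<Sum>j<d. ?h ([c j] \<cdot>\<^bsub>G\<^esub> b j)) = (\<Sum>j<d. c j * ?h (b j))] (mod p)"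
  proof (rule cong_sum)
    fix j assume "j \<in> {..<d}"
    then have "b j \<in> S" using basis_sub by auto
    with M.additive_cong_pow[where h = ?h and n = "c j", OF sub_closed h]
    show "[?h ([c j] \<cdot>\<^bsub>G\<^esub> b j) = c j * ?h (b j)] (mod p)" by blast
  qed
  finally show ?thesis by (simp add: mult.commute)
qed

lemma index_less: "t < l \<Longrightarrow> j < d \<Longrightarrow> t * d + j < l * d"
proof -
  assume "t < l" "j < d"
  then have "t * d + j < Suc t * d" by simp
  also have "\<dots> \<le> l * d" using \<open>t < l\<close> by (intro mult_le_mono1) simp
  finally show ?thesis .
qed

lemma div_less: "q < l * d \<Longrightarrow> q div d < l"
  by (simp add: less_mult_imp_div_less)

lemma contract_sub: "contract l c \<in> vectors S l"
  by (simp add: contract_def vectors_def lincomb_sub)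

lemma expand_vectors: "x \<in> vectors S l \<Longrightarrow> expand l x \<in> vectors (carrier K) (l * d)"
  using d_pos by (auto simp: expand_def vectors_def PiE_iff div_less intro!: coords_less)

lemma contract_expand:
  assumes "x \<in> vectors S l"
  shows "contract l (expand l x) = x"
proof -
  have "contract l (expand l x) t = x t" if t: "t < l" for t
  proof -
    have "contract l (expand l x) t = lincomb G b d (coords (x t))"
      using t d_pos index_less[OF t] unfolding contract_def
      by (auto intro!: M.lincomb_cong basis_carrier simp: expand_def)
    moreover have "x t \<in> S" using t assms by (auto simp: vectors_def)
    ultimately show ?thesis by (simp add: lincomb_coords)
  qed
  then show ?thesis
    using assms by (intro extensionalityI[of _ "{..<l}"]) (simp_all add: contract_def vectors_def PiE_iff)
qed

text \<open>\<open>coords_lincomb\<close> returns coefficients modulo \<open>p\<close>, and the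
  entries of \<open>c\<close> are already below \<open>p\<close>.\<close>

lemma expand_contract:
  assumes "c \<in> vectors (carrier K) (l * d)"
  shows "expand l (contract l c) = c"
proof -
  have "expand l (contract l c) q = c q" if q: "q < l * d" for q
  proof -
    have "c q < p" using assms q by (auto simp: vectors_def)
    then show ?thesis
      using q d_pos by (simp add: expand_def contract_def div_less coords_lincomb)
  qed
  then show ?thesis
    using assms by (intro extensionalityI[of _ "{..<l * d}"]) (simp_all add: expand_def vectors_def PiE_iff)
qed

section \<open>Linear maps in coordinates\<close>

definition contract_inputs ::
    "(nat \<Rightarrow> nat) \<Rightarrow> nat \<Rightarrow> 'e signal set \<Rightarrow> ('e signal \<Rightarrow> nat \<Rightarrow> nat)
      \<Rightarrow> 'e signal \<Rightarrow> nat \<Rightarrow> 'g" where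
  "contract_inputs k n A z = (\<lambda>s\<in>A. contract (signal_length k n s) (z s))"

lemma signal_length_expand: "signal_length (\<lambda>i. k i * d) (n * d) s = signal_length k n s * d"
  by (cases s) simp_all

lemma contract_inputs_sub:
  "contract_inputs k n (node_signals N v) z \<in> node_inputs N S k n v"
  by (simp add: contract_inputs_def node_inputs_def contract_sub)

lemma node_inputs_sub: "node_inputs N S k n v \<subseteq> node_inputs N (carrier G) k n v"
  unfolding node_inputs_def vectors_def using sub_carrier by (intro PiE_mono) auto

text \<open>\<open>S\<close> is closed under scalars and finite sums, so a matrix over
  \<open>R\<close> maps vectors over \<open>S\<close> to vectors over \<open>S\<close>; this
  restricts a linear code to \<open>S\<close>.\<close>

lemma linear_map_sub:
  assumes fin: "finite (node_signals N v)" and lin: "linear_map R G N k n v l f"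
    and z: "z \<in> node_inputs N S k n v"
  shows "f z \<in> vectors S l"
proof -
  let ?P = "input_positions N k n v"
  have "z \<in> node_inputs N (carrier G) k n v" using z node_inputs_sub by (rule rev_subsetD)
  then obtain A where A: "A \<in> {..<l} \<rightarrow> ?P \<rightarrow> carrier R"
    and f: "f z = (\<lambda>r\<in>{..<l}. \<Oplus>\<^bsub>G\<^esub>c\<in>?P. A r c \<odot>\<^bsub>G\<^esub> z (fst c) (snd c))"
    using lin unfolding linear_map_def by (elim bexE) (simp only:)
  have "z (fst c) (snd c) \<in> S" if "c \<in> ?P" for c
    using node_inputs_value[OF z that] .
  moreover have "finite ?P" using fin by (simp add: input_positions_def)
  ultimately show ?thesis
    using A by (auto simp: f vectors_def intro!: sub_finsum sub_smult)
qed

text \<open>Division with remainder by \<open>d\<close> matches a position \<open>t\<close> and a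
  coordinate \<open>j\<close> with the finer position \<open>t * d + j\<close>.\<close>

lemma sum_input_positions_expand:
  fixes g :: "'e signal \<Rightarrow> nat \<Rightarrow> nat \<Rightarrow> nat"
  assumes "finite (node_signals N v)"
  shows "(\<Sum>c\<in>input_positions N k n v. \<Sum>j<d. g (fst c) (snd c) j) =
    (\<Sum>c\<in>input_positions N (\<lambda>i. k i * d) (n * d) v. g (fst c) (snd c div d) (snd c mod d))"
  unfolding sum.cartesian_product
  by (rule sum.reindex_bij_witness[where
        i = "\<lambda>(s, q). ((s, q div d), q mod d)" and j = "\<lambda>((s, t), j). (s, t * d + j)"])
     (use d_pos in \<open>auto simp: input_positions_def signal_length_expand div_less index_less
        simp del: signal_length.simps\<close>)

text \<open>Each entry of the matrix over \<open>R\<close> becomes a \<open>d\<close> by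
  \<open>d\<close> block of residues, the matrix of that scalar on \<open>S\<close>.\<close>

lemma linear_map_expand:
  fixes N :: "('v, 'e) network"
  assumes fin: "finite (node_signals N v)" and lin: "linear_map R G N k n v l f"
  shows "linear_map (tensor_ring K (opposite_ring K)) (two_sided_module K)
    N (\<lambda>i. k i * d) (n * d) v (l * d)
    (\<lambda>z. expand l (f (contract_inputs k n (node_signals N v) z)))"
proof -
  let ?P = "input_positions N k n v" and ?Q = "input_positions N (\<lambda>i. k i * d) (n * d) v"
  let ?T = "tensor_ring K (opposite_ring K)" and ?M = "two_sided_module K"
  let ?I = "node_inputs N (carrier ?M) (\<lambda>i. k i * d) (n * d) v"
  obtain A where A: "A \<in> {..<l} \<rightarrow> ?P \<rightarrow> carrier R"
    and f: "\<And>z. z \<in> node_inputs N (carrier G) k n v \<Longrightarrow>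
      f z = (\<lambda>r\<in>{..<l}. \<Oplus>\<^bsub>G\<^esub>c\<in>?P. A r c \<odot>\<^bsub>G\<^esub> z (fst c) (snd c))"
    using lin unfolding linear_map_def by blast
  \<comment> \<open>Quotients by \<open>d\<close> locate a block and remainders an entry in it:
    coordinate \<open>q mod d\<close> of the image of basis element
    \<open>snd c mod d\<close>.\<close>
  define B where "B q c = coords (A (q div d) (fst c, snd c div d) \<odot>\<^bsub>G\<^esub> b (snd c mod d)) (q mod d)"
    for q c
  have finP: "finite ?P" "finite ?Q" using fin by (simp_all add: input_positions_def)
  have AR: "A t c \<in> carrier R" if "t < l" "c \<in> ?P" for t c using A that by auto
  have Q: "(fst c, snd c div d) \<in> ?P" if "c \<in> ?Q" for c
    using that by (auto simp: input_positions_def signal_length_expand div_less simp del: signal_length.simps)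
  have B: "B q c < p" if "q < l * d" "c \<in> ?Q" for q c
    unfolding B_def using that Q[of c] d_pos basis_sub
    by (intro coords_less sub_smult AR) (auto simp: div_less)
  have M: "carrier ?M = {..<p}" by (simp add: two_sided_module_def)
  have cr: "cring K" using p_gt_1 by (intro nat_residue_ring_cring) simp
  \<comment> \<open>Each residue has to be realised by an element of the tensor ring acting as
    multiplication by it.\<close>
  have "\<exists>t\<in>carrier ?T. \<forall>x<p. t \<odot>\<^bsub>?M\<^esub> x = B q c * x mod p" if "q < l * d" "c \<in> ?Q" for q c
    using two_sided_scalar[OF cr, of "B q c"] B[OF that] by (metis lessThan_iff nat_residue_ring_simps(1,2))
  then obtain T where T: "\<And>q c. q < l * d \<Longrightarrow> c \<in> ?Q \<Longrightarrow> T q c \<in> carrier ?T"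
    "\<And>q c x. q < l * d \<Longrightarrow> c \<in> ?Q \<Longrightarrow> x < p \<Longrightarrow> T q c \<odot>\<^bsub>?M\<^esub> x = B q c * x mod p"
    by metis
  show ?thesis
    unfolding linear_map_def
  proof (intro bexI[of _ T] ballI)
    fix z assume z: "z \<in> ?I"
    let ?w = "contract_inputs k n (node_signals N v) z"
    have zp: "z (fst c) (snd c) < p" if "c \<in> ?Q" for c
      using node_inputs_value[OF z that] unfolding M by simp

    have w: "?w \<in> node_inputs N (carrier G) k n v"
      by (rule subsetD[OF node_inputs_sub contract_inputs_sub])
    have w': "?w (fst c) (snd c) = lincomb G b d (\<lambda>j. z (fst c) (snd c * d + j))" if "c \<in> ?P" for c
      using that by (auto simp: contract_inputs_def contract_def input_positions_def simp del: signal_length.simps)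
    have wS: "?w (fst c) (snd c) \<in> S" if "c \<in> ?P" for c
      using w'[OF that] lincomb_sub by simp
    show "expand l (f ?w) =
        (\<lambda>q\<in>{..<l * d}. \<Oplus>\<^bsub>?M\<^esub>c\<in>?Q. T q c \<odot>\<^bsub>?M\<^esub> z (fst c) (snd c))"
      unfolding expand_def
    proof (rule restrict_ext)
      fix q assume "q \<in> {..<l * d}"
      then have q: "q < l * d" by simp
      let ?t = "q div d" and ?i = "q mod d"
      have t: "?t < l" and i: "?i < d" using q div_less d_pos by auto
      have fw: "f ?w ?t = (\<Oplus>\<^bsub>G\<^esub>c\<in>?P. A ?t c \<odot>\<^bsub>G\<^esub> ?w (fst c) (snd c))"
        using t by (simp add: f[OF w])
      have AS: "(\<lambda>c. A ?t c \<odot>\<^bsub>G\<^esub> ?w (fst c) (snd c)) \<in> ?P \<rightarrow> S"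
        by (intro Pi_I sub_smult AR[OF t] wS)
      have fS: "f ?w ?t \<in> S" unfolding fw using finP(1) AS by (rule sub_finsum)
      have "[coords (f ?w ?t) ?i = (\<Sum>c\<in>?P. coords (A ?t c \<odot>\<^bsub>G\<^esub> ?w (fst c) (snd c)) ?i)] (mod p)"
        unfolding fw
        using M.additive_cong_finsum[where h = "\<lambda>x. coords x ?i",
            OF sub_closed coords_add[OF _ _ i] finP(1) AS]
        by simp
      \<comment> \<open>Insert the basis expansion of each input symbol and apply the matrix of each
        scalar.\<close>
      also have "[(\<Sum>c\<in>?P. coords (A ?t c \<odot>\<^bsub>G\<^esub> ?w (fst c) (snd c)) ?i) =
          (\<Sum>c\<in>?P. \<Sum>j<d. coords (A ?t (fst c, snd c) \<odot>\<^bsub>G\<^esub> b j) ?i * z (fst c) (snd c * d + j))] (mod p)"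
        by (rule cong_sum) (simp add: w' coords_smult_lincomb[OF AR[OF t] i])
      also have "(\<Sum>c\<in>?P. \<Sum>j<d. coords (A ?t (fst c, snd c) \<odot>\<^bsub>G\<^esub> b j) ?i * z (fst c) (snd c * d + j)) =
          (\<Sum>c\<in>?Q. B q c * z (fst c) (snd c))"
        by (subst sum_input_positions_expand[OF fin,
              where g = "\<lambda>s t j. coords (A ?t (s, t) \<odot>\<^bsub>G\<^esub> b j) ?i * z s (t * d + j)"])
           (simp add: B_def)
      \<comment> \<open>A coordinate is already reduced, so the congruence is an equation.\<close>
      finally have "coords (f ?w ?t) ?i = (\<Sum>c\<in>?Q. B q c * z (fst c) (snd c)) mod p"
        using coords_less[OF fS i] by (simp add: cong_def)
      also have "\<dots> = (\<Sum>c\<in>?Q. T q c \<odot>\<^bsub>?M\<^esub> z (fst c) (snd c)) mod p"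
        by (simp add: T(2)[OF q _ zp] mod_sum_eq)
      also have "\<dots> = (\<Oplus>\<^bsub>?M\<^esub>c\<in>?Q. T q c \<odot>\<^bsub>?M\<^esub> z (fst c) (snd c))"
        unfolding finsum_two_sided_module
        using p_gt_1 finP by (subst finsum_nat_residue_ring) (auto simp: T(2)[OF q _ zp])
      finally show "coords (f ?w ?t) ?i = \<dots>" .
    qed
  qed (use T(1) in auto)
qed

section \<open>The expanded code\<close>

definition expand_code :: "('v, 'e) network \<Rightarrow> (nat \<Rightarrow> nat) \<Rightarrow> nat \<Rightarrow> ('v, 'e, 'g) code \<Rightarrow> ('v, 'e, nat) code"
  where
  "expand_code N k n C =
    \<lparr>edge_fun = \<lambda>e z. expand n (edge_fun C e (contract_inputs k n (node_signals N (tail (graph N) e)) z)),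
     decoding_fun = \<lambda>v i z. expand (k i) (decoding_fun C v i (contract_inputs k n (node_signals N v) z))\<rparr>"

text \<open>Contracting every signal turns a transmission of the expanded code into one of the
  original code. Its decoders return the contracted messages, and expanding these recovers the
  messages.\<close>

lemma linear_solution_expand:
  assumes net: "network N" and sol: "linear_solution_over_module N R G k n C"
  shows "linear_solution_over_module N (tensor_ring K (opposite_ring K)) (two_sided_module K)
    (\<lambda>i. k i * d) (n * d) (expand_code N k n C)"
proof -
  interpret network N by fact
  let ?C = "expand_code N k n C" and ?k = "\<lambda>i. k i * d"
  have fin: "finite (node_signals N v)" for v
    unfolding node_signals_def by (auto simp: in_arcs_def)
  have lin_e: "linear_map R G N k n (tail (graph N) e) n (edge_fun C e)" if "e \<in> arcs (graph N)" for e
    using sol that by (simp add: linear_solution_over_module_def)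
  have lin_d: "linear_map R G N k n v (k i) (decoding_fun C v i)"
    if "v \<in> receivers N" "i \<in> demands N v" for v i
    using sol that by (simp add: linear_solution_over_module_def)
  have M: "carrier (two_sided_module K) = carrier K" by (simp add: two_sided_module_def)
  have edge: "edge_fun C e (contract_inputs k n (node_signals N (tail (graph N) e)) z) \<in> vectors S n"
    if "e \<in> arcs (graph N)" for e z
    using linear_map_sub[OF fin lin_e[OF that] contract_inputs_sub] .
  have dec: "decoding_fun C v i (contract_inputs k n (node_signals N v) z) \<in> vectors S (k i)"
    if "v \<in> receivers N" "i \<in> demands N v" for v i z
    using linear_map_sub[OF fin lin_d[OF that] contract_inputs_sub] .
  have code: "is_code N (carrier K) ?k (n * d) ?C"
    using sol edge dec d_pos p_gt_1
    by (auto simp: is_code_def linear_solution_over_module_def is_solution_def expand_code_def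
        simp del: nat_residue_ring_simps(1) intro!: expand_vectors)
       simp_all
  have "decoding_fun ?C v i (restrict z (node_signals N v)) = x i"
    if x: "x \<in> (\<Pi>\<^sub>E i\<in>{..<message_count N}. vectors (carrier K) (?k i))"
      and z: "transmission N ?C x z" and v: "v \<in> receivers N" "i \<in> demands N v" for x z v i
  proof -
    define y where "y = (\<lambda>i\<in>{..<message_count N}. contract (k i) (x i))"
    define w where "w = contract_inputs k n (network_signals N) z"
    have sub: "node_signals N v \<subseteq> network_signals N" for v
      by (auto simp: node_signals_def network_signals_def)
    \<comment> \<open>\<open>contract_inputs\<close> acts signal by signal and takes any set of
      signals, so contracting all signals and restricting to a node agrees with contracting the
      inputs of the node.\<close>
    have res: "contract_inputs k n (node_signals N v) (restrict z (node_signals N v)) =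
        restrict w (node_signals N v)" for v
      using sub[of v] by (auto simp: w_def contract_inputs_def fun_eq_iff restrict_def)
    have "transmission N C y w"
      unfolding transmission_def
    proof (intro conjI allI impI ballI)
      show "w \<in> extensional (network_signals N)" by (simp add: w_def contract_inputs_def)
      show "w (Message i) = y i" if "i < message_count N" for i
        using that z by (simp add: w_def y_def contract_inputs_def network_signals_def transmission_def)
      fix e assume e: "e \<in> arcs (graph N)"
      then have "w (Carried e) = contract n (z (Carried e))"
        by (simp add: w_def contract_inputs_def network_signals_def)
      also have "z (Carried e) = expand n (edge_fun C e (restrict w (node_signals N (tail (graph N) e))))"
        using z e by (simp add: transmission_def expand_code_def res)
      \<comment> \<open>The output of the original edge function lies over \<open>S\<close>, where
        \<open>contract\<close> undoes \<open>expand\<close>.\<close>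
      also have "contract n \<dots> = edge_fun C e (restrict w (node_signals N (tail (graph N) e)))"
        using edge[OF e] res by (intro contract_expand) metis
      finally show "w (Carried e) = edge_fun C e (restrict w (node_signals N (tail (graph N) e)))" .
    qed
    \<comment> \<open>Messages over \<open>S\<close> are messages over \<open>G\<close>, so the
      original decoders are correct on them.\<close>
    moreover have "y \<in> (\<Pi>\<^sub>E i\<in>{..<message_count N}. vectors (carrier G) (k i))"
      using contract_sub sub_carrier by (fastforce simp: y_def vectors_def)
    ultimately have "decoding_fun C v i (restrict w (node_signals N v)) = y i"
      using sol v by (simp add: linear_solution_over_module_def is_solution_def)
    moreover have i: "i < message_count N" using demands_messages v by auto
    ultimately have "decoding_fun ?C v i (restrict z (node_signals N v)) = expand (k i) (contract (k i) (x i))"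
      by (simp add: expand_code_def res y_def)
    also have "\<dots> = x i" using x i by (intro expand_contract) auto
    finally show ?thesis .
  qed
  then have "is_solution N (carrier K) ?k (n * d) ?C"
    using code by (simp add: is_solution_def)
  moreover have "linear_map (tensor_ring K (opposite_ring K)) (two_sided_module K) N ?k (n * d)
      (tail (graph N) e) (n * d) (edge_fun ?C e)" if "e \<in> arcs (graph N)" for e
    using linear_map_expand[OF fin lin_e[OF that]] by (simp add: expand_code_def)
  moreover have "linear_map (tensor_ring K (opposite_ring K)) (two_sided_module K) N ?k (n * d)
      v (?k i) (decoding_fun ?C v i)" if "v \<in> receivers N" "i \<in> demands N v" for v i
    using linear_map_expand[OF fin lin_d[OF that]] by (simp add: expand_code_def)
  ultimately show ?thesis
    unfolding linear_solution_over_module_def M by blast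
qed

text \<open>All block sizes gain the same factor \<open>d\<close>, which cancels in the rates, so
  solutions transfer for each \<epsilon> separately.\<close>

lemma asymptotically_solvable_over_prime_field:
  assumes "network N" "asymptotically_linearly_solvable_over_module N R G"
  shows "asymptotically_linearly_solvable_over_ring N K"
  unfolding asymptotically_linearly_solvable_over_ring_def asymptotically_linearly_solvable_over_module_def
proof (intro allI impI)
  fix \<epsilon> :: rat assume "0 < \<epsilon> \<and> \<epsilon> < 1"
  then obtain k n C where "linear_solution_over_module N R G k n C"
    "\<forall>i<message_count N. of_nat (k i) / of_nat n = 1 - \<epsilon>"
    using assms(2) unfolding asymptotically_linearly_solvable_over_module_def by blast
  then show "\<exists>k n C. linear_solution_over_module N (tensor_ring K (opposite_ring K)) (two_sided_module K) k n C \<and>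
      (\<forall>i<message_count N. of_nat (k i) / of_nat n = 1 - \<epsilon>)"
    using d_pos
    by (intro exI[of _ "\<lambda>i. k i * d"] exI[of _ "n * d"] exI[of _ "expand_code N k n C"])
       (simp add: linear_solution_expand[OF assms(1)])
qed

end

section \<open>Existence of the torsion submodule and conclusion\<close>

lemma elementary_submodule_exists:
  fixes R :: "('r, 'm) ring_scheme" and G :: "('r, 'g) module"
  assumes "left_module R G" "finite (carrier G)" "2 \<le> card (carrier G)"
  obtains p d b S where "elementary_submodule R G p d b S"
proof -
  interpret left_module R G by fact
  obtain p x where p: "Factorial_Ring.prime p" "x \<in> carrier G" "x \<noteq> \<zero>\<^bsub>G\<^esub>" "[(p::nat)] \<cdot>\<^bsub>G\<^esub> x = \<zero>\<^bsub>G\<^esub>"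
    using M.exists_prime_torsion assms by blast
  define S where "S = {x \<in> carrier G. [p] \<cdot>\<^bsub>G\<^esub> x = \<zero>\<^bsub>G\<^esub>}"
  have smult_zero: "a \<odot>\<^bsub>G\<^esub> \<zero>\<^bsub>G\<^esub> = \<zero>\<^bsub>G\<^esub>" if "a \<in> carrier R" for a
    using smult_r_distr[OF that, of "\<zero>\<^bsub>G\<^esub>" "\<zero>\<^bsub>G\<^esub>"] that by (simp add: M.add.l_cancel_one)
  \<comment> \<open>Scalars act additively and so commute with multiples; hence the
    \<open>p\<close>-torsion elements are stable under \<open>R\<close>.\<close>
  have smult_pow: "[m] \<cdot>\<^bsub>G\<^esub> (a \<odot>\<^bsub>G\<^esub> x) = a \<odot>\<^bsub>G\<^esub> ([m] \<cdot>\<^bsub>G\<^esub> x)"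
    if "a \<in> carrier R" "x \<in> carrier G" for a x and m :: nat
    by (induction m) (use that in \<open>simp_all add: smult_zero smult_r_distr\<close>)
  have S: "S \<subseteq> carrier G" "\<zero>\<^bsub>G\<^esub> \<in> S" "\<And>x y. x \<in> S \<Longrightarrow> y \<in> S \<Longrightarrow> x \<oplus>\<^bsub>G\<^esub> y \<in> S"
    "\<And>x. x \<in> S \<Longrightarrow> [p] \<cdot>\<^bsub>G\<^esub> x = \<zero>\<^bsub>G\<^esub>"
    by (auto simp: S_def M.add.nat_pow_distrib)
  obtain d b where b: "b \<in> {..<d} \<rightarrow> S" "bij_betw (lincomb G b d) (vectors {..<p} d) S"
    using M.elementary_abelian_basis[OF p(1) _ S] finite_subset[OF S(1) assms(2)] by blast
  have "d \<noteq> 0"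
  proof
    assume "d = 0"
    \<comment> \<open>The only coefficient vector of length 0 is \<open>undefined\<close>
      everywhere, so \<open>S\<close> would be a singleton, although it contains zero and
      \<open>x\<close>.\<close>
    then have "S = {lincomb G b d (\<lambda>_. undefined)}"
      using b(2) by (auto simp: bij_betw_def vectors_def)
    moreover have "x \<in> S" using p by (simp add: S_def)
    ultimately show False using S(2) p(3) by auto
  qed
  moreover have "a \<odot>\<^bsub>G\<^esub> x \<in> S" if "a \<in> carrier R" "x \<in> S" for a x
    using that by (simp add: S_def smult_pow smult_zero)
  ultimately have "elementary_submodule R G p d b S"
    using p(1) S b by unfold_locales auto
  then show ?thesis by (rule that)
qed

text \<open>Covers both alternatives of the theorem: the type of scalars is arbitrary, so
  \<open>R\<close> may be a tensor ring.\<close>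

lemma prime_field_of_module:
  fixes N :: "('v, 'e) network" and G :: "('r, 'g) module"
  assumes "network N" "left_module R G" "finite (carrier G)" "2 \<le> card (carrier G)"
    "asymptotically_linearly_solvable_over_module N R G"
  shows "\<exists>K :: nat ring. field K \<and> finite (carrier K) \<and> asymptotically_linearly_solvable_over_ring N K"
proof -
  obtain p d b S where "elementary_submodule R G p d b S"
    using elementary_submodule_exists assms(2-4) by blast
  then interpret elementary_submodule R G p d b S .
  show ?thesis
    using nat_residue_ring_field[OF prime_p] asymptotically_solvable_over_prime_field[OF assms(1,5)]
    by (intro exI[of _ K]) simp
qed

theorem corollary4p6:
  fixes N :: "('v, 'e) network"
  assumes "network N"
    and "(\<exists>(R :: 'r ring) (G :: ('r, 'g) module).
            left_module R G \<and> finite (carrier G) \<and> 2 \<le> card (carrier G) \<and>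
            asymptotically_linearly_solvable_over_module N R G) \<or>
         (\<exists>S :: 's ring.
            ring S \<and> finite (carrier S) \<and> 2 \<le> card (carrier S) \<and>
            asymptotically_linearly_solvable_over_ring N S)"
  shows "\<exists>K :: nat ring. field K \<and> finite (carrier K) \<and>
           asymptotically_linearly_solvable_over_ring N K"
  using assms(2)
proof (elim disjE exE conjE)
  fix S :: "'s ring"
  assume S: "ring S" "finite (carrier S)" "2 \<le> card (carrier S)"
    "asymptotically_linearly_solvable_over_ring N S"
  \<comment> \<open>A linear code over the ring \<open>S\<close> is by definition a code over its
    two-sided module, which has the same finite carrier; so the module case applies.\<close>
  have "carrier (two_sided_module S) = carrier S" by (simp add: two_sided_module_def)
  with S show ?thesis
    unfolding asymptotically_linearly_solvable_over_ring_def[of N S]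
    by (intro prime_field_of_module[OF assms(1) two_sided_module_is_left_module[OF S(1)]]) simp_all
qed (rule prime_field_of_module[OF assms(1)])

end
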